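(* If $X$ is a hereditarily indecomposable complex Banach space, then $X$ is not a universal Jamison space.
   Context: $\mathbb{T}=\{\lambda\in\mathbb{C} : |\lambda|=1\}$; $\mathcal{B}(X)$ is the algebra of bounded linear operators on $X$; $\sigma_p(T)=\{\lambda\in\mathbb{C} : \mathrm{Ker}(T-\lambda)\neq\{0\}\}$ is the point spectrum of $T\in\mathcal{B}(X)$. An infinite-dimensional Banach space $X$ is decomposable if there exist two infinite-dimensional closed subspaces $Y$ and $Z$ of $X$ such that $X=Y\oplus Z$. $X$ is hereditarily indecomposable if it is infinite-dimensional and no infinite-dimensional closed subspace of $X$ is decomposable. If $(n_k)_{k\ge 0}$ is an increasing sequence of positive integers, $T\in\mathcal{B}(X)$ is partially power-bounded with respect to $(n_k)_{k\ge 0}$ if $\sup_{k\ge 0}\|T^{n_k}\|<+\infty$. The sequence $(n_k)_{k\ge 0}$ is a Jamison sequence if for every separable complex Banach space $Y$ and every $T\in\mathcal{B}(Y)$ which is partially power-bounded with respect to $(n_k)_{k\ge 0}$, the set $\sigma_p(T)\cap\mathbb{T}$ is at most countable. $X$ is a universal Jamison space if it is a separable infinite-dimensional complex Banach space and for any increasing sequence of positive integers $(n_k)_{k\ge 0}$ which is not a Jamison sequence, there exists $T\in\mathcal{B}(X)$ which is partially power-bounded with respect to $(n_k)_{k\ge 0}$ and such that $\sigma_p(T)\cap\mathbb{T}$ is uncountable. *)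

theory Defs
  imports "HOL-Analysis.Analysis"
begin

class complex_normed_vector = real_normed_vector +
  fixes scaleC :: "complex \<Rightarrow> 'a \<Rightarrow> 'a"  (infixr \<open>*\<^sub>C\<close> 75)
  assumes scaleC_add_right: "a *\<^sub>C (x + y) = a *\<^sub>C x + a *\<^sub>C y"
    and scaleC_add_left: "(a + b) *\<^sub>C x = a *\<^sub>C x + b *\<^sub>C x"
    and scaleC_scaleC: "a *\<^sub>C b *\<^sub>C x = (a * b) *\<^sub>C x"
    and scaleC_one: "1 *\<^sub>C x = x"
    and scaleR_scaleC: "r *\<^sub>R x = complex_of_real r *\<^sub>C x"
    and norm_scaleC: "norm (a *\<^sub>C x) = cmod a * norm x"

class complex_banach = complex_normed_vector + banach

global_interpretation complex_vector:
  vector_space "scaleC :: complex \<Rightarrow> 'a \<Rightarrow> 'a::complex_normed_vector"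
  by unfold_locales
    (simp_all add: scaleC_add_right scaleC_add_left scaleC_scaleC scaleC_one)


subsection \<open>Operators on a Banach space given as a type\<close>

definition complex_operator :: "('a::complex_banach \<Rightarrow> 'a) \<Rightarrow> bool" where
  "complex_operator T \<longleftrightarrow> bounded_linear T \<and> (\<forall>c x. T (c *\<^sub>C x) = c *\<^sub>C T x)"

definition point_spectrum :: "('a::complex_banach \<Rightarrow> 'a) \<Rightarrow> complex set" where
  "point_spectrum T = {l. {x. T x - l *\<^sub>C x = 0} \<noteq> {0}}"

definition partially_power_bounded ::
    "('a::complex_banach \<Rightarrow> 'a) \<Rightarrow> (nat \<Rightarrow> nat) \<Rightarrow> bool" where
  "partially_power_bounded T n \<longleftrightarrow> bdd_above (range (\<lambda>k. onorm (T ^^ n k)))"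


subsection \<open>Banach spaces given by a carrier set\<close>

text \<open>
  A Jamison sequence is defined by a quantification over all separable complex Banach spaces.
  HOL cannot quantify over types inside a formula, so these spaces are represented by a carrier
  set with explicit operations.
\<close>

record 'b cspace =
  vcarrier :: "'b set"
  vadd :: "'b \<Rightarrow> 'b \<Rightarrow> 'b"
  vzero :: 'b
  vscale :: "complex \<Rightarrow> 'b \<Rightarrow> 'b"
  vnorm :: "'b \<Rightarrow> real"

definition vdiff :: "'b cspace \<Rightarrow> 'b \<Rightarrow> 'b \<Rightarrow> 'b" where
  "vdiff Y x y = vadd Y x (vscale Y (- 1) y)"

text \<open>
  The locale \<open>Metric_space\<close> requires nonnegativity and symmetry also off the carrier, hence
  the value \<open>0\<close> there.
\<close>

definition vdist :: "'b cspace \<Rightarrow> 'b \<Rightarrow> 'b \<Rightarrow> real" where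
  "vdist Y x y =
    (if x \<in> vcarrier Y \<and> y \<in> vcarrier Y then vnorm Y (vdiff Y x y) else 0)"

definition complex_vector_space_on :: "'b cspace \<Rightarrow> bool" where
  "complex_vector_space_on Y \<longleftrightarrow>
    (let V = vcarrier Y; add = vadd Y; zero = vzero Y; smul = vscale Y in
      zero \<in> V \<and>
      (\<forall>x\<in>V. \<forall>y\<in>V. add x y \<in> V) \<and>
      (\<forall>a. \<forall>x\<in>V. smul a x \<in> V) \<and>
      (\<forall>x\<in>V. \<forall>y\<in>V. \<forall>z\<in>V. add (add x y) z = add x (add y z)) \<and>
      (\<forall>x\<in>V. \<forall>y\<in>V. add x y = add y x) \<and>
      (\<forall>x\<in>V. add zero x = x) \<and>
      (\<forall>x\<in>V. \<exists>y\<in>V. add x y = zero) \<and>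
      (\<forall>a. \<forall>x\<in>V. \<forall>y\<in>V. smul a (add x y) = add (smul a x) (smul a y)) \<and>
      (\<forall>a b. \<forall>x\<in>V. smul (a + b) x = add (smul a x) (smul b x)) \<and>
      (\<forall>a b. \<forall>x\<in>V. smul a (smul b x) = smul (a * b) x) \<and>
      (\<forall>x\<in>V. smul 1 x = x))"

definition complex_normed_space_on :: "'b cspace \<Rightarrow> bool" where
  "complex_normed_space_on Y \<longleftrightarrow>
    complex_vector_space_on Y \<and>
    (\<forall>x\<in>vcarrier Y. 0 \<le> vnorm Y x) \<and>
    (\<forall>x\<in>vcarrier Y. vnorm Y x = 0 \<longleftrightarrow> x = vzero Y) \<and>
    (\<forall>x\<in>vcarrier Y. \<forall>y\<in>vcarrier Y. vnorm Y (vadd Y x y) \<le> vnorm Y x + vnorm Y y) \<and>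
    (\<forall>a. \<forall>x\<in>vcarrier Y. vnorm Y (vscale Y a x) = cmod a * vnorm Y x)"

definition separable_complex_banach_on :: "'b cspace \<Rightarrow> bool" where
  "separable_complex_banach_on Y \<longleftrightarrow>
    complex_normed_space_on Y \<and>
    Metric_space.mcomplete (vcarrier Y) (vdist Y) \<and>
    separable_space (Metric_space.mtopology (vcarrier Y) (vdist Y))"

definition complex_operator_on :: "'b cspace \<Rightarrow> ('b \<Rightarrow> 'b) \<Rightarrow> bool" where
  "complex_operator_on Y T \<longleftrightarrow>
    (\<forall>x\<in>vcarrier Y. T x \<in> vcarrier Y) \<and>
    (\<forall>x\<in>vcarrier Y. \<forall>y\<in>vcarrier Y. T (vadd Y x y) = vadd Y (T x) (T y)) \<and>
    (\<forall>c. \<forall>x\<in>vcarrier Y. T (vscale Y c x) = vscale Y c (T x)) \<and>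
    (\<exists>K. \<forall>x\<in>vcarrier Y. vnorm Y (T x) \<le> vnorm Y x * K)"

definition onorm_on :: "'b cspace \<Rightarrow> ('b \<Rightarrow> 'b) \<Rightarrow> real" where
  "onorm_on Y T = (SUP x\<in>vcarrier Y. vnorm Y (T x) / vnorm Y x)"

definition point_spectrum_on :: "'b cspace \<Rightarrow> ('b \<Rightarrow> 'b) \<Rightarrow> complex set" where
  "point_spectrum_on Y T =
    {l. {x \<in> vcarrier Y. vdiff Y (T x) (vscale Y l x) = vzero Y} \<noteq> {vzero Y}}"

definition partially_power_bounded_on ::
    "'b cspace \<Rightarrow> ('b \<Rightarrow> 'b) \<Rightarrow> (nat \<Rightarrow> nat) \<Rightarrow> bool" where
  "partially_power_bounded_on Y T n \<longleftrightarrow> bdd_above (range (\<lambda>k. onorm_on Y (T ^^ n k)))"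


subsection \<open>Jamison sequences and universal Jamison spaces\<close>

definition increasing_positive :: "(nat \<Rightarrow> nat) \<Rightarrow> bool" where
  "increasing_positive n \<longleftrightarrow> strict_mono n \<and> (\<forall>k. 0 < n k)"

text \<open>
  Taking the carriers inside \<open>nat \<Rightarrow> real\<close> loses no generality: if \<open>d\<close> enumerates a dense subset
  of a separable space, then \<open>x \<mapsto> (\<lambda>k. dist x (d k))\<close> is injective, and the structure
  can be transported along it. Lemma \<open>jamison_sequence_imp_countable\<close> below carries this
  out for arbitrary types.
\<close>

definition jamison_sequence :: "(nat \<Rightarrow> nat) \<Rightarrow> bool" where
  "jamison_sequence n \<longleftrightarrow>
    (\<forall>(Y :: (nat \<Rightarrow> real) cspace) T.
      separable_complex_banach_on Y \<longrightarrow> complex_operator_on Y T \<longrightarrow>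
      partially_power_bounded_on Y T n \<longrightarrow>
      countable (point_spectrum_on Y T \<inter> sphere 0 1))"

definition infinite_dim :: "'a::complex_banach set \<Rightarrow> bool" where
  "infinite_dim E \<longleftrightarrow> \<not> (\<exists>B. finite B \<and> complex_vector.span B = E)"

definition universal_jamison_space :: "'a::complex_banach itself \<Rightarrow> bool" where
  "universal_jamison_space X \<longleftrightarrow>
    separable_space (euclidean :: 'a topology) \<and>
    infinite_dim (UNIV :: 'a set) \<and>
    (\<forall>n. increasing_positive n \<longrightarrow> \<not> jamison_sequence n \<longrightarrow>
      (\<exists>T :: 'a \<Rightarrow> 'a. complex_operator T \<and> partially_power_bounded T n \<and>
        uncountable (point_spectrum T \<inter> sphere 0 1)))"


subsection \<open>Hereditarily indecomposable spaces\<close>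

definition closed_csubspace :: "'a::complex_banach set \<Rightarrow> bool" where
  "closed_csubspace E \<longleftrightarrow> complex_vector.subspace E \<and> closed E"

text \<open>
  Here \<open>E\<close> is itself a closed subspace of the ambient Banach space, so its closed subspaces are
  the closed subspaces of the ambient space that it contains.
\<close>

definition decomposable :: "'a::complex_banach set \<Rightarrow> bool" where
  "decomposable E \<longleftrightarrow>
    (\<exists>Y Z. closed_csubspace Y \<and> closed_csubspace Z \<and>
      infinite_dim Y \<and> infinite_dim Z \<and>
      Y \<inter> Z = {0} \<and> E = {y + z | y z. y \<in> Y \<and> z \<in> Z})"

definition hereditarily_indecomposable :: "'a::complex_banach itself \<Rightarrow> bool" where
  "hereditarily_indecomposable X \<longleftrightarrow>
    infinite_dim (UNIV :: 'a set) \<and>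
    (\<forall>E :: 'a set. closed_csubspace E \<longrightarrow> infinite_dim E \<longrightarrow> \<not> decomposable E)"


subsection \<open>Jamison sequences and Banach spaces given as types\<close>

lemma jamison_sequence_imp_countable:
  fixes T :: "'a::complex_banach \<Rightarrow> 'a"
  assumes jam: "jamison_sequence n"
    and sep: "separable_space (euclidean :: 'a topology)"
    and T: "complex_operator T"
    and pb: "partially_power_bounded T n"
  shows "countable (point_spectrum T \<inter> sphere 0 1)"
proof -
  obtain D :: "'a set" where D: "countable D" "closure D = UNIV"
    using sep by (auto simp: separable_space_def)
  have "D \<noteq> {}" using D by auto
  then obtain d :: "nat \<Rightarrow> 'a" where d: "range d = D"
    using D(1) by (metis range_from_nat_into)
  define f where "f x = (\<lambda>k. dist x (d k))" for x
  define g where "g = inv f"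
  have "inj f"
  proof (rule injI, rule ccontr)
    fix x y assume fxy: "f x = f y" and "x \<noteq> y"
    then have "dist x y / 2 > 0" by simp
    then obtain z where z: "z \<in> D" "dist z x < dist x y / 2"
      using D(2) closure_approachable[of x D] by blast
    obtain k where k: "z = d k" using z(1) d by blast
    have "dist x z = dist y z" using fxy k by (simp add: f_def fun_eq_iff)
    moreover have "dist x y \<le> dist x z + dist y z"
      by (rule dist_triangle2)
    ultimately show False using z(2) by (simp add: dist_commute)
  qed
  then have gf [simp]: "g (f x) = x" for x by (simp add: g_def)
  define Y where "Y = \<lparr>vcarrier = range f, vadd = (\<lambda>u v. f (g u + g v)), vzero = f 0,
    vscale = (\<lambda>c u. f (c *\<^sub>C g u)), vnorm = (\<lambda>u. norm (g u))\<rparr>"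
  have Y [simp]: "vcarrier Y = range f" "vadd Y u v = f (g u + g v)" "vzero Y = f 0"
    "vscale Y c u = f (c *\<^sub>C g u)" "vnorm Y u = norm (g u)" for u v c
    by (simp_all add: Y_def)
  have finj [simp]: "f x = f y \<longleftrightarrow> x = y" for x y
    using \<open>inj f\<close> by (simp add: inj_eq)
  have diff [simp]: "vdiff Y (f x) (f y) = f (x - y)" for x y
    by (simp add: vdiff_def complex_vector.scale_minus_left scaleC_one)
  have vdist [simp]: "vdist Y (f x) (f y) = dist x y" for x y
    by (simp add: vdist_def dist_norm)
  have sp: "complex_normed_space_on Y"
  proof -
    have inverse: "\<exists>y. x + y = 0" for x :: 'a
      by (rule exI[of _ "- x"]) simp
    show ?thesis
      unfolding complex_normed_space_on_def complex_vector_space_on_def Let_def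
      by (simp add: inverse add.assoc scaleC_add_right scaleC_add_left scaleC_scaleC
          scaleC_one norm_scaleC norm_triangle_ineq)
  qed
  interpret M: Metric_space "range f" "vdist Y"
  proof
    show "0 \<le> vdist Y x y" for x y by (simp add: vdist_def)
    show "vdist Y x y = vdist Y y x" for x y
      by (auto simp: vdist_def[of Y x y] vdist_def[of Y y x] norm_minus_commute)
    show "(vdist Y x y = 0) = (x = y)" if "x \<in> range f" "y \<in> range f" for x y
      using that by auto
    show "vdist Y x z \<le> vdist Y x y + vdist Y y z"
      if "x \<in> range f" "y \<in> range f" "z \<in> range f" for x y z
      using that by (auto intro: dist_triangle)
  qed
  have lim: "limitin M.mtopology (\<lambda>k. f (s k)) (f x) sequentially \<longleftrightarrow> s \<longlonglongrightarrow> x" for s x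
    by (simp add: M.limitin_metric tendsto_iff)
  have complete: "M.mcomplete"
    unfolding M.mcomplete_def
  proof (intro allI impI)
    fix s assume s: "M.MCauchy s"
    have r: "s k \<in> range f" for k using s by (auto simp: M.MCauchy_def)
    then have fg: "f (g (s k)) = s k" for k by (metis gf rangeE)
    have sdist: "vdist Y (s i) (s j) = dist (g (s i)) (g (s j))" for i j
      by (metis fg vdist)
    have "Cauchy (\<lambda>k. g (s k))"
    proof (rule metric_CauchyI)
      fix e :: real assume "e > 0"
      then obtain N where "\<forall>i j. N \<le> i \<longrightarrow> N \<le> j \<longrightarrow> vdist Y (s i) (s j) < e"
        using s unfolding M.MCauchy_def by blast
      then show "\<exists>N. \<forall>i\<ge>N. \<forall>j\<ge>N. dist (g (s i)) (g (s j)) < e"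
        using sdist by (intro exI[of _ N]) simp
    qed
    then obtain x where "(\<lambda>k. g (s k)) \<longlonglongrightarrow> x"
      using Cauchy_convergent convergent_def by blast
    then have "limitin M.mtopology (\<lambda>k. f (g (s k))) (f x) sequentially"
      by (simp add: lim)
    then show "\<exists>x. limitin M.mtopology s x sequentially" by (auto simp: fg)
  qed
  have separable: "separable_space M.mtopology"
    unfolding separable_space_def
  proof (intro exI conjI)
    show "countable (f ` D)" using D(1) by simp
    show "f ` D \<subseteq> topspace M.mtopology" by auto
    show "M.mtopology closure_of (f ` D) = topspace M.mtopology"
    proof -
      have "f x \<in> M.mtopology closure_of (f ` D)" for x
      proof -
        have "\<exists>y\<in>f ` D. y \<in> M.mball (f x) r" if "r > 0" for r
        proof -
          obtain z where "z \<in> D" "dist z x < r"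
            using D(2) closure_approachable[of x D] \<open>r > 0\<close> by blast
          then show ?thesis by (auto simp: dist_commute)
        qed
        then show ?thesis by (auto simp: M.metric_closure_of)
      qed
      then have "topspace M.mtopology \<subseteq> M.mtopology closure_of (f ` D)"
        unfolding M.topspace_mtopology by (rule image_subsetI)
      with closure_of_subset_topspace show ?thesis by (rule subset_antisym)
    qed
  qed
  have banach: "separable_complex_banach_on Y"
    using sp complete separable by (simp add: separable_complex_banach_on_def)
  define S where "S = f \<circ> T \<circ> g"
  have lin: "bounded_linear T" and homog: "T (c *\<^sub>C x) = c *\<^sub>C T x" for c x
    using T by (auto simp: complex_operator_def)
  have op: "complex_operator_on Y S"
    using lin homog bounded_linear.bounded[OF lin]
    by (auto simp: complex_operator_on_def S_def linear_add bounded_linear.linear)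
  have pow: "(S ^^ m) (f x) = f ((T ^^ m) x)" for m x
    by (induction m) (simp_all add: S_def)
  have "onorm_on Y (S ^^ m) = onorm (T ^^ m)" for m
    by (simp add: onorm_on_def onorm_def image_image pow)
  then have "partially_power_bounded_on Y S n"
    using pb by (simp add: partially_power_bounded_on_def partially_power_bounded_def)
  with jam banach op have "countable (point_spectrum_on Y S \<inter> sphere 0 1)"
    by (auto simp: jamison_sequence_def)
  moreover have "point_spectrum_on Y S = point_spectrum T"
  proof -
    have "{x \<in> vcarrier Y. vdiff Y (S x) (vscale Y l x) = vzero Y} = f ` {x. T x - l *\<^sub>C x = 0}"
      for l by (auto simp: S_def)
    moreover have "f ` A = {f 0} \<longleftrightarrow> A = {0}" for A
      using inj_image_eq_iff[OF \<open>inj f\<close>, of A "{0}"] by simp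
    ultimately show ?thesis by (simp add: point_spectrum_on_def point_spectrum_def)
  qed
  ultimately show ?thesis by simp
qed

end

theory Submission
  imports Defs "HOL-Library.Ramsey"
begin

text \<open>
  Two facts contradict each other on a space that is both hereditarily indecomposable and a
  universal Jamison space: every operator on a hereditarily indecomposable complex Banach space has
  a countable point spectrum, and some increasing sequence, here that of the factorials, is not a
  Jamison sequence.

  For the first fact, call \<open>l\<close> exceptional for \<open>T\<close> if \<open>T - l\<close> is not upper semi-Fredholm.  In that
  case every \<open>e > 0\<close> admits an infinite-dimensional closed subspace on which \<open>T - l\<close> has norm at
  most \<open>e\<close> (lemma \<open>not_upper_semi_fredholm_small_on_subspace\<close>, by constructing a basic sequence of
  almost eigenvectors).  For two different exceptional points and small \<open>e\<close>, the sum of two such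
  almost eigenspaces is direct and closed (lemma \<open>almost_eigenspaces_direct_sum\<close>), which hereditary
  indecomposability forbids.  So there is at most one exceptional point \<open>l\<^sub>0\<close>.  If \<open>T - l\<close> is upper
  semi-Fredholm, then a punctured neighbourhood of \<open>l\<close> consists either of eigenvalues only or of no
  eigenvalues at all (lemma \<open>upper_semi_fredholm_punctured_nbhd\<close>).  Therefore the limit points of the
  point spectrum in the connected set \<open>- {l\<^sub>0}\<close> form an open and closed subset of it; as the point spectrum
  is bounded, this subset is empty, and the point spectrum is countable.

  For the second fact, let \<open>w m = 2 powr (- s m)\<close>, where \<open>s m\<close> is the least number of factorials
  with sum \<open>m\<close>.  On the sequences with \<open>w m * norm (x m)\<close> bounded, the powers \<open>k!\<close> of the left shift
  have norm at most \<open>2\<close>, because \<open>s (m + k!) \<le> s m + 1\<close>.  Every point \<open>a\<close> of the unit circle is an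
  eigenvalue, with eigenvector \<open>(a\<^sup>m)\<^sub>m\<close>, and two such eigenvectors for \<open>a\<close> and \<open>b\<close>
  have a distance of at most the supremum over \<open>k\<close> of \<open>cmod (a ^ k! - b ^ k!)\<close>.  The uncountably many points
  \<open>exp (2 \<pi> \<i> \<theta>)\<close>, where \<open>\<theta>\<close> is the sum of \<open>1/(j+2)!\<close> over \<open>j\<close> in an arbitrary set \<open>A\<close>, are separable
  for this distance, the finite sets \<open>A\<close> being dense.  The closed span of their eigenvectors is thus a
  separable Banach space, and on it the shift has the required properties.
\<close>

section \<open>Complex operators and closed complex subspaces\<close>

lemma bounded_linear_scaleC: "bounded_linear (scaleC c :: 'a::complex_normed_vector \<Rightarrow> 'a)"
proof (rule bounded_linear_intro)
  show "c *\<^sub>C (r *\<^sub>R x) = r *\<^sub>R (c *\<^sub>C x)" for r and x :: 'a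
    by (simp add: scaleR_scaleC scaleC_scaleC mult.commute)
  show "norm (c *\<^sub>C x) \<le> norm x * cmod c" for x :: 'a
    by (simp add: norm_scaleC mult.commute)
qed (simp add: scaleC_add_right)

lemma tendsto_scaleC:
  fixes f :: "'b \<Rightarrow> 'a::complex_normed_vector"
  assumes "(a \<longlongrightarrow> l) F" "(f \<longlongrightarrow> x) F"
  shows "((\<lambda>n. a n *\<^sub>C f n) \<longlongrightarrow> l *\<^sub>C x) F"
proof -
  have b: "bounded_bilinear (scaleC :: complex \<Rightarrow> 'a \<Rightarrow> 'a)"
  proof
    show "\<exists>K. \<forall>(a::complex) x::'a. norm (a *\<^sub>C x) \<le> norm a * norm x * K"
      by (rule exI[of _ 1]) (simp add: norm_scaleC)
    show "(r *\<^sub>R a) *\<^sub>C b = r *\<^sub>R (a *\<^sub>C b)" "a *\<^sub>C (r *\<^sub>R b) = r *\<^sub>R (a *\<^sub>C b)"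
      for r a and b :: 'a
      by (simp_all add: scaleR_scaleC scaleC_scaleC mult.commute scaleR_conv_of_real)
  qed (simp_all add: scaleC_add_left scaleC_add_right)
  show ?thesis by (rule bounded_bilinear.tendsto[OF b assms])
qed

lemma complex_operatorD:
  assumes "complex_operator S"
  shows "bounded_linear S" "S (c *\<^sub>C x) = c *\<^sub>C S x" "S (x + y) = S x + S y"
    "S (x - y) = S x - S y" "S 0 = 0"
proof -
  show b: "bounded_linear S" and "S (c *\<^sub>C x) = c *\<^sub>C S x"
    using assms by (auto simp: complex_operator_def)
  interpret bounded_linear S by (rule b)
  show "S (x + y) = S x + S y" "S (x - y) = S x - S y" "S 0 = 0"
    by (rule add diff zero)+
qed

lemma complex_operator_minus_scaleC:
  assumes "complex_operator T"
  shows "complex_operator (\<lambda>x. T x - l *\<^sub>C x)"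
  unfolding complex_operator_def
proof (intro conjI allI)
  show "bounded_linear (\<lambda>x. T x - l *\<^sub>C x)"
    by (rule bounded_linear_sub[OF complex_operatorD(1)[OF assms] bounded_linear_scaleC])
  show "T (c *\<^sub>C x) - l *\<^sub>C c *\<^sub>C x = c *\<^sub>C (T x - l *\<^sub>C x)" for c x
    unfolding complex_operatorD(2)[OF assms] complex_vector.scale_right_diff_distrib scaleC_scaleC
    by (simp only: mult.commute)
qed

lemma eigenvalue_minus_scaleC:
  "m \<in> point_spectrum (\<lambda>x. T x - l *\<^sub>C x) \<longleftrightarrow> l + m \<in> point_spectrum T"
  unfolding point_spectrum_def by (simp only: scaleC_add_left diff_diff_eq mem_Collect_eq)

lemma point_spectrum_iff:
  assumes "complex_operator T"
  shows "l \<in> point_spectrum T \<longleftrightarrow> (\<exists>x. x \<noteq> 0 \<and> T x = l *\<^sub>C x)"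
proof -
  have "0 \<in> {x. T x - l *\<^sub>C x = 0}"
    by (simp only: mem_Collect_eq complex_operatorD(5)[OF assms] complex_vector.scale_zero_right diff_self)
  then have "l \<in> point_spectrum T \<longleftrightarrow> (\<exists>x. x \<noteq> 0 \<and> T x - l *\<^sub>C x = 0)"
    unfolding point_spectrum_def by blast
  then show ?thesis by (simp only: right_minus_eq)
qed

lemma closed_csubspaceD:
  assumes "closed_csubspace W"
  shows "closed W" "0 \<in> W" "x \<in> W \<Longrightarrow> y \<in> W \<Longrightarrow> x + y \<in> W" "x \<in> W \<Longrightarrow> y \<in> W \<Longrightarrow> x - y \<in> W"
    "x \<in> W \<Longrightarrow> c *\<^sub>C x \<in> W"
  using assms
  by (auto simp: closed_csubspace_def complex_vector.subspace_0 complex_vector.subspace_add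
      complex_vector.subspace_diff complex_vector.subspace_scale)

lemma closed_csubspace_closure:
  fixes W :: "'a::complex_banach set"
  assumes "complex_vector.subspace W"
  shows "closed_csubspace (closure W)"
proof -
  have "x + y \<in> closure W" if xy: "x \<in> closure W" "y \<in> closure W" for x y
  proof -
    obtain f g where f: "\<forall>n. f n \<in> W" "f \<longlonglongrightarrow> x" and g: "\<forall>n. g n \<in> W" "g \<longlonglongrightarrow> y"
      using xy by (auto simp: closure_sequential)
    have "\<forall>n. f n + g n \<in> W" using f(1) g(1) complex_vector.subspace_add[OF assms] by blast
    with tendsto_add[OF f(2) g(2)] show ?thesis
      unfolding closure_sequential by (intro exI[of _ "\<lambda>n. f n + g n"] conjI)
  qed
  moreover have "c *\<^sub>C x \<in> closure W" if x: "x \<in> closure W" for x c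
  proof -
    obtain f where f: "\<forall>n. f n \<in> W" "f \<longlonglongrightarrow> x"
      using x by (auto simp: closure_sequential)
    have "\<forall>n. c *\<^sub>C f n \<in> W" using f(1) complex_vector.subspace_scale[OF assms] by blast
    with tendsto_scaleC[OF tendsto_const f(2)] show ?thesis
      unfolding closure_sequential by (intro exI[of _ "\<lambda>n. c *\<^sub>C f n"] conjI)
  qed
  moreover have "0 \<in> closure W"
    using complex_vector.subspace_0[OF assms] closure_subset by blast
  ultimately show ?thesis
    by (simp add: closed_csubspace_def complex_vector.subspace_def)
qed

lemma subspace_image_complex_operator:
  assumes "complex_operator S" "complex_vector.subspace W"
  shows "complex_vector.subspace (S ` W)"
proof -
  interpret S: module_hom scaleC scaleC S
    by unfold_locales (simp_all add: complex_operatorD[OF assms(1)])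
  show ?thesis by (rule S.subspace_image[OF assms(2)])
qed


section \<open>Upper semi-Fredholm operators\<close>

text \<open>
  An operator is upper semi-Fredholm, that is, has closed range and finite-dimensional kernel, if
  and only if its restrictions to closed bounded sets are proper.  The sequential form of properness
  below passes to closed subspaces at once and makes every later argument a compactness argument.
\<close>

definition upper_semi_fredholm :: "('a::complex_banach \<Rightarrow> 'a) \<Rightarrow> bool" where
  "upper_semi_fredholm S \<longleftrightarrow>
    (\<forall>x. bounded (range x) \<longrightarrow> convergent (\<lambda>n. S (x n)) \<longrightarrow>
      (\<exists>r :: nat \<Rightarrow> nat. strict_mono r \<and> convergent (x \<circ> r)))"

lemma upper_semi_fredholmD:
  fixes x :: "nat \<Rightarrow> 'a::complex_banach"
  assumes "upper_semi_fredholm S" "complex_operator S"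
    and "\<And>n. norm (x n) \<le> B" "(\<lambda>n. S (x n)) \<longlonglongrightarrow> y"
  obtains r z where "strict_mono (r :: nat \<Rightarrow> nat)" "(x \<circ> r) \<longlonglongrightarrow> z" "S z = y"
proof -
  have "bounded (range x)" using assms(3) by (auto simp: bounded_iff)
  then obtain r z where r: "strict_mono (r :: nat \<Rightarrow> nat)" "(x \<circ> r) \<longlonglongrightarrow> z"
    using assms(1,4) unfolding upper_semi_fredholm_def convergent_def by meson
  have "(\<lambda>n. S ((x \<circ> r) n)) \<longlonglongrightarrow> S z"
    using r(2) complex_operatorD(1)[OF assms(2)] by (rule bounded_linear.tendsto[rotated])
  moreover have "(\<lambda>n. S ((x \<circ> r) n)) \<longlonglongrightarrow> y"
    using LIMSEQ_subseq_LIMSEQ[OF assms(4) r(1)] by (simp add: o_def)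
  ultimately show ?thesis using that[OF r] LIMSEQ_unique by blast
qed

text \<open>
  The constant is uniform along a decreasing sequence of subspaces, because almost minimal
  preimages violating every bound would have a limit point in the kernel of \<open>S\<close> and in all the
  subspaces, and subtracting it would produce much smaller preimages.
\<close>

lemma upper_semi_fredholm_uniform_lift:
  fixes S :: "'a::complex_banach \<Rightarrow> 'a"
  assumes usf: "upper_semi_fredholm S" and op: "complex_operator S"
    and W: "\<And>n. closed_csubspace (W n)" and dec: "decseq W"
  obtains C :: real and m :: nat where "C > 0"
    "\<And>n y. m \<le> n \<Longrightarrow> y \<in> W n \<Longrightarrow> \<exists>z\<in>W n. S z = S y \<and> norm z \<le> C * norm (S y)"
proof -
  have "\<exists>m. \<forall>n\<ge>m. \<forall>y\<in>W n. \<exists>z\<in>W n. S z = S y \<and> norm z \<le> real (Suc m) * norm (S y)"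
  proof (rule ccontr)
    assume neg: "\<not> ?thesis"
    have "\<exists>n u. k \<le> n \<and> u \<in> W n \<and> norm u = 1 \<and> norm (S u) \<le> inverse (real (Suc k)) \<and>
        (\<forall>z\<in>W n. S z = S u \<longrightarrow> 1 / 2 < norm z)" for k
    proof -
      obtain n y where n: "k \<le> n" "y \<in> W n"
        and bad: "\<And>z. z \<in> W n \<Longrightarrow> S z = S y \<Longrightarrow> real (Suc k) * norm (S y) < norm z"
        using neg by (meson not_le)
      have "S y \<noteq> 0"
        using bad[of 0] closed_csubspaceD(2)[OF W] complex_operatorD(5)[OF op] by auto
      \<comment> \<open>a preimage of norm less than twice the infimum \<open>d\<close>, to be scaled to norm \<open>1\<close>\<close>
      define A where "A = norm ` {z \<in> W n. S z = S y}"
      define d where "d = Inf A"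
      have A: "A \<noteq> {}" "bdd_below A" using n by (auto simp: A_def intro: bdd_belowI[of _ 0])
      have "real (Suc k) * norm (S y) \<le> d"
        unfolding d_def by (rule cInf_greatest[OF A(1)]) (use bad in \<open>force simp: A_def\<close>)
      moreover have "0 < real (Suc k) * norm (S y)" using \<open>S y \<noteq> 0\<close> by simp
      ultimately have "0 < d" by linarith
      then have "Inf A < 2 * d" by (simp add: d_def)
      then obtain z where z: "z \<in> W n" "S z = S y" "norm z < 2 * d"
        using cInf_lessD[OF A(1)] unfolding A_def by blast
      have dle: "d \<le> norm z'" if "z' \<in> W n" "S z' = S y" for z'
        unfolding d_def by (rule cInf_lower[OF _ A(2)]) (use that in \<open>auto simp: A_def\<close>)
      have z0: "norm z > 0" using dle[OF z(1,2)] \<open>0 < d\<close> by linarith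
      define c where "c = complex_of_real (inverse (norm z))"
      have "norm (c *\<^sub>C z) = 1" using z0 by (simp add: norm_scaleC c_def norm_inverse)
      moreover have "norm (S (c *\<^sub>C z)) \<le> inverse (real (Suc k))"
      proof -
        have "real (Suc k) * norm (S y) < norm z" using bad z by blast
        then have "norm (S y) / norm z \<le> 1 / real (Suc k)"
          using z0 by (simp add: field_simps)
        moreover have "norm (S (c *\<^sub>C z)) = norm (S y) / norm z"
          by (simp add: complex_operatorD(2)[OF op] norm_scaleC c_def norm_inverse z(2) divide_inverse mult.commute)
        ultimately show ?thesis by (simp add: inverse_eq_divide)
      qed
      moreover have "1 / 2 < norm z'" if z': "z' \<in> W n" "S z' = S (c *\<^sub>C z)" for z'
      proof -
        have "S (complex_of_real (norm z) *\<^sub>C z') = S y"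
          using z0 by (simp add: complex_operatorD(2)[OF op] z'(2) scaleC_scaleC c_def z(2) scaleC_one
              flip: of_real_mult)
        then have "d \<le> norm (complex_of_real (norm z) *\<^sub>C z')"
          using dle z'(1) closed_csubspaceD(5)[OF W] by blast
        then have "norm z < norm z * (2 * norm z')" using z(3) by (simp add: norm_scaleC)
        then show ?thesis using z0 by simp
      qed
      moreover have "c *\<^sub>C z \<in> W n" using z(1) closed_csubspaceD(5)[OF W] by blast
      ultimately show ?thesis using n(1) by blast
    qed
    then obtain n u where n: "\<And>k. k \<le> n k" and u: "\<And>k. u k \<in> W (n k)" "\<And>k. norm (u k) = 1"
        "\<And>k. norm (S (u k)) \<le> inverse (real (Suc k))"
      and min: "\<And>k z. z \<in> W (n k) \<Longrightarrow> S z = S (u k) \<Longrightarrow> 1 / 2 < norm z"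
      by metis
    have "(\<lambda>k. S (u k)) \<longlonglongrightarrow> 0"
      by (rule Lim_null_comparison[OF _ LIMSEQ_inverse_real_of_nat]) (use u(3) in simp)
    then obtain r v where r: "strict_mono r" "(u \<circ> r) \<longlonglongrightarrow> v" "S v = 0"
      using upper_semi_fredholmD[OF usf op, of u 1 0] u(2) by (metis order_refl)
    have v: "v \<in> W j" for j
    proof (rule Lim_in_closed_set[OF closed_csubspaceD(1)[OF W] _ _ r(2)])
      have "(u \<circ> r) k \<in> W j" if "j \<le> k" for k
      proof -
        have "j \<le> n (r k)" using that seq_suble[OF r(1), of k] n[of "r k"] by linarith
        then show ?thesis using u(1)[of "r k"] decseqD[OF dec] by auto
      qed
      then show "eventually (\<lambda>k. (u \<circ> r) k \<in> W j) sequentially"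
        by (rule eventually_sequentiallyI)
    qed simp
    have "eventually (\<lambda>k. dist ((u \<circ> r) k) v < 1 / 2) sequentially"
      using r(2) by (rule tendstoD) simp
    then obtain k where "dist (u (r k)) v < 1 / 2"
      by (auto simp: eventually_sequentially)
    moreover have "1 / 2 < norm (u (r k) - v)"
      by (rule min[of _ "r k"])
        (simp_all add: complex_operatorD[OF op] r(3) closed_csubspaceD(4)[OF W] u(1) v)
    ultimately show False by (simp add: dist_norm)
  qed
  then show ?thesis using that by (metis of_nat_0_less_iff zero_less_Suc)
qed

text \<open>
  By the preceding lemma for a constant sequence of subspaces, the members of a convergent sequence of
  images have bounded preimages.
\<close>

lemma upper_semi_fredholm_closed_image:
  assumes usf: "upper_semi_fredholm S" and op: "complex_operator S" and W: "closed_csubspace W"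
  shows "closed_csubspace (S ` W)"
proof -
  have dec: "decseq (\<lambda>_. W)" by (simp add: decseq_def)
  obtain C and m :: nat
    where C: "\<And>n y. m \<le> n \<Longrightarrow> y \<in> W \<Longrightarrow> \<exists>z\<in>W. S z = S y \<and> norm z \<le> C * norm (S y)"
    using upper_semi_fredholm_uniform_lift[OF usf op W dec] by metis
  have "closed (S ` W)"
    unfolding closed_sequential_limits
  proof safe
    fix y l assume y: "\<forall>n. y n \<in> S ` W" and lim: "y \<longlonglongrightarrow> l"
    have "\<exists>z\<in>W. S z = y n \<and> norm z \<le> C * norm (y n)" for n
      using y C[of m] by (metis image_iff order_refl)
    then obtain z where z: "\<And>n. z n \<in> W" "\<And>n. S (z n) = y n" "\<And>n. norm (z n) \<le> C * norm (y n)"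
      by metis
    obtain B where B: "\<And>n. norm (y n) \<le> B" "B > 0"
      using convergent_imp_bounded[OF lim] unfolding bounded_pos by blast
    have "norm (z n) \<le> \<bar>C\<bar> * B" for n
    proof -
      have "C * norm (y n) \<le> \<bar>C\<bar> * B" by (rule mult_mono) (use B in auto)
      with z(3)[of n] show ?thesis by (rule order_trans)
    qed
    moreover have "(\<lambda>n. S (z n)) \<longlonglongrightarrow> l" using lim by (simp add: z(2))
    ultimately obtain r x where r: "strict_mono r" "(z \<circ> r) \<longlonglongrightarrow> x" "S x = l"
      using upper_semi_fredholmD[OF usf op] by blast
    have "x \<in> W"
      using closed_sequentially[OF closed_csubspaceD(1)[OF W] _ r(2)] z(1) by simp
    then show "l \<in> S ` W" using r(3) by blast
  qed
  then show ?thesis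
    using subspace_image_complex_operator[OF op] W by (simp add: closed_csubspace_def)
qed

lemma closed_csubspace_range_funpow:
  assumes "upper_semi_fredholm S" "complex_operator S"
  shows "closed_csubspace (range (S ^^ n))"
proof (induction n)
  case 0
  show ?case by (simp add: closed_csubspace_def)
next
  case (Suc n)
  have "range (S ^^ Suc n) = S ` range (S ^^ n)" by (simp add: image_comp o_def)
  then show ?case using upper_semi_fredholm_closed_image[OF assms Suc] by simp
qed

lemma decseq_range_funpow: "decseq (\<lambda>n. range (f ^^ n))" for f :: "'b \<Rightarrow> 'b"
proof (rule decseq_SucI)
  show "range (f ^^ Suc n) \<subseteq> range (f ^^ n)" for n
    by (auto simp: funpow_Suc_right simp del: funpow.simps)
qed

text \<open>
  On the intersection of the ranges of its powers, an upper semi-Fredholm operator is onto and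
  open: preimages lying in the ranges of higher and higher powers can be chosen with a common bound,
  and a limit point of them lies in all these closed ranges.
\<close>

lemma upper_semi_fredholm_core_lift:
  fixes S :: "'a::complex_banach \<Rightarrow> 'a"
  assumes usf: "upper_semi_fredholm S" and op: "complex_operator S"
  obtains C where "C > 0"
    "\<And>x. x \<in> (\<Inter>n. range (S ^^ n)) \<Longrightarrow>
      \<exists>y\<in>(\<Inter>n. range (S ^^ n)). S y = x \<and> norm y \<le> C * norm x"
proof -
  let ?W = "\<lambda>n. range (S ^^ n)"
  note W = closed_csubspace_range_funpow[OF usf op]
  obtain C m where C: "C > 0"
    "\<And>n y. m \<le> n \<Longrightarrow> y \<in> ?W n \<Longrightarrow> \<exists>z\<in>?W n. S z = S y \<and> norm z \<le> C * norm (S y)"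
    using upper_semi_fredholm_uniform_lift[OF usf op W decseq_range_funpow] by blast
  have "\<exists>y\<in>(\<Inter>n. ?W n). S y = x \<and> norm y \<le> C * norm x" if x: "x \<in> (\<Inter>n. ?W n)" for x
  proof -
    have "\<exists>z. z \<in> ?W (m + n) \<and> S z = x \<and> norm z \<le> C * norm x" for n
    proof -
      have "x \<in> ?W (Suc (m + n))" using x by blast
      then obtain y where "y \<in> ?W (m + n)" "S y = x" by auto
      then show ?thesis using C(2)[of "m + n" y] by auto
    qed
    then obtain z where z: "\<And>n. z n \<in> ?W (m + n)" "\<And>n. S (z n) = x"
      "\<And>n. norm (z n) \<le> C * norm x" by metis
    have "(\<lambda>n. S (z n)) \<longlonglongrightarrow> x" by (simp add: z(2))
    with z(3) obtain r y where r: "strict_mono r" "(z \<circ> r) \<longlonglongrightarrow> y" "S y = x"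
      using upper_semi_fredholmD[OF usf op] by blast
    have "y \<in> ?W j" for j
    proof (rule Lim_in_closed_set[OF closed_csubspaceD(1)[OF W] _ _ r(2)])
      have "(z \<circ> r) k \<in> ?W j" if "j \<le> k" for k
      proof -
        have "j \<le> m + r k" using that seq_suble[OF r(1), of k] by linarith
        then have "?W (m + r k) \<subseteq> ?W j" by (rule decseqD[OF decseq_range_funpow])
        then show ?thesis using z(1)[of "r k"] by auto
      qed
      then show "eventually (\<lambda>k. (z \<circ> r) k \<in> ?W j) sequentially"
        by (rule eventually_sequentiallyI)
    qed simp
    moreover have "norm y \<le> C * norm x"
      by (rule Lim_bounded[OF tendsto_norm[OF r(2)]]) (simp add: z(3))
    ultimately show ?thesis using r(3) by blast
  qed
  with C(1) that show ?thesis by blast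
qed

text \<open>
  The eigenvectors of \<open>S\<close> for nonzero eigenvalues lie in the intersection of the ranges of the
  powers of \<open>S\<close>.  If \<open>S\<close> is injective there, it is bounded below there and has no small nonzero
  eigenvalue.  If it kills some \<open>x\<^sub>0 \<noteq> 0\<close> there, then a chain of preimages
  \<open>S x\<^sub>k\<^sub>+\<^sub>1 = x\<^sub>k\<close> of at most geometric growth gives the eigenvector \<open>\<Sum>k. m\<^sup>k x\<^sub>k\<close> for every
  small \<open>m\<close>.
\<close>

lemma upper_semi_fredholm_punctured_nbhd:
  fixes S :: "'a::complex_banach \<Rightarrow> 'a"
  assumes usf: "upper_semi_fredholm S" and op: "complex_operator S"
  obtains r where "r > 0" "(\<forall>m. 0 < cmod m \<and> cmod m < r \<longrightarrow> m \<in> point_spectrum S) \<or>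
    (\<forall>m. 0 < cmod m \<and> cmod m < r \<longrightarrow> m \<notin> point_spectrum S)"
proof -
  define V where "V = (\<Inter>n. range (S ^^ n))"
  obtain C where C: "C > 0" "\<And>x. x \<in> V \<Longrightarrow> \<exists>y\<in>V. S y = x \<and> norm y \<le> C * norm x"
    using upper_semi_fredholm_core_lift[OF usf op] unfolding V_def by blast
  have V: "closed_csubspace V"
    using closed_csubspace_range_funpow[OF usf op]
    by (auto simp: V_def closed_csubspace_def intro!: complex_vector.subspace_Inter)
  note lin = complex_operatorD[OF op]
  show ?thesis
  proof (cases "\<exists>x\<in>V. x \<noteq> 0 \<and> S x = 0")
    case True
    then obtain x0 where x0: "x0 \<in> V" "x0 \<noteq> 0" "S x0 = 0" by blast
    have "\<exists>x. \<forall>n. (x n \<in> V \<and> (n = 0 \<longrightarrow> x n = x0)) \<and>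
        S (x (Suc n)) = x n \<and> norm (x (Suc n)) \<le> C * norm (x n)"
    proof (rule dependent_nat_choice)
      show "\<exists>y. y \<in> V \<and> (0 = (0::nat) \<longrightarrow> y = x0)" using x0(1) by blast
      show "\<exists>y'. (y' \<in> V \<and> (Suc n = 0 \<longrightarrow> y' = x0)) \<and> S y' = y \<and> norm y' \<le> C * norm y"
        if "y \<in> V \<and> (n = 0 \<longrightarrow> y = x0)" for y n
        using C(2)[of y] that by auto
    qed
    then obtain x where x: "x 0 = x0" "\<And>n. S (x (Suc n)) = x n"
      "\<And>n. norm (x (Suc n)) \<le> C * norm (x n)" by metis
    have xn: "norm (x n) \<le> C ^ n * norm x0" for n
    proof (induction n)
      case (Suc n)
      have "norm (x (Suc n)) \<le> C * norm (x n)" by (rule x(3))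
      also have "\<dots> \<le> C * (C ^ n * norm x0)" using Suc C(1) by (intro mult_left_mono) auto
      finally show ?case by (simp add: mult.assoc)
    qed (simp add: x(1))
    have "m \<in> point_spectrum S" if m: "cmod m < 1 / (2 * C)" for m
    proof -
      define q where "q = cmod m * C"
      have q: "0 \<le> q" "q < 1 / 2" using m C(1) by (auto simp: q_def field_simps)
      define f where "f n = m ^ n *\<^sub>C x n" for n
      have f: "norm (f n) \<le> norm x0 * q ^ n" for n
      proof -
        have "norm (f n) = cmod m ^ n * norm (x n)"
          by (simp add: f_def norm_scaleC norm_power)
        also have "\<dots> \<le> cmod m ^ n * (C ^ n * norm x0)" by (intro mult_left_mono xn) simp
        finally show ?thesis by (simp add: q_def power_mult_distrib mult_ac)
      qed
      have sumq: "summable (\<lambda>n. norm x0 * q ^ n)" using q by (intro summable_mult summable_geometric) simp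
      have sumf: "summable f" by (rule summable_comparison_test'[OF sumq, of 0]) (use f in simp)
      have sumSf: "summable (\<lambda>n. f (Suc n))" using sumf by (simp add: summable_Suc_iff)
      define y where "y = suminf f"
      have y: "y = x0 + (\<Sum>n. f (Suc n))"
        using suminf_split_head[OF sumf] by (simp add: y_def f_def x(1) scaleC_one)
      have "S (f (Suc n)) = m *\<^sub>C f n" for n
        by (simp add: f_def lin x(2) scaleC_scaleC)
      moreover have "S y = S x0 + (\<Sum>n. S (f (Suc n)))"
        unfolding y lin(3) using bounded_linear.suminf[OF lin(1) sumSf] by simp
      ultimately have "S y = (\<Sum>n. m *\<^sub>C f n)" using x0(3) by simp
      also have "\<dots> = m *\<^sub>C y"
        unfolding y_def using bounded_linear.suminf[OF bounded_linear_scaleC sumf] by simp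
      finally have "S y = m *\<^sub>C y" .
      moreover have "y \<noteq> 0"
      proof
        assume "y = 0"
        then have "x0 = - (\<Sum>n. f (Suc n))" using y by (simp add: eq_neg_iff_add_eq_0)
        then have "norm x0 = norm (\<Sum>n. f (Suc n))" by simp
        also have "\<dots> \<le> (\<Sum>n. norm x0 * q ^ Suc n)"
        proof (rule norm_suminf_le)
          show "norm (f (Suc n)) \<le> norm x0 * q ^ Suc n" for n by (rule f)
          show "summable (\<lambda>n. norm x0 * q ^ Suc n)"
            using sumq by (subst summable_Suc_iff)
        qed
        also have "\<dots> = norm x0 * (q / (1 - q))"
        proof (rule sums_unique[symmetric])
          have "(\<lambda>n. norm x0 * q * q ^ n) sums (norm x0 * q * (1 / (1 - q)))"
            using q by (intro sums_mult geometric_sums) simp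
          then show "(\<lambda>n. norm x0 * q ^ Suc n) sums (norm x0 * (q / (1 - q)))"
            by (simp add: mult.assoc)
        qed
        also have "\<dots> < norm x0 * 1"
          using x0(2) q by (intro mult_strict_left_mono) (auto simp: field_simps)
        finally show False by simp
      qed
      ultimately show ?thesis by (auto simp: point_spectrum_iff[OF op])
    qed
    then show ?thesis using that[of "1 / (2 * C)"] C(1) by simp
  next
    case False
    have "m \<notin> point_spectrum S" if m: "0 < cmod m" "cmod m < 1 / C" for m
    proof
      assume "m \<in> point_spectrum S"
      then obtain x where x: "x \<noteq> 0" "S x = m *\<^sub>C x" by (auto simp: point_spectrum_iff[OF op])
      have pow: "(S ^^ n) (c *\<^sub>C x) = (c * m ^ n) *\<^sub>C x" for n c
        by (induction n) (simp_all add: lin x(2) scaleC_scaleC mult_ac)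
      have "x = (S ^^ n) (inverse (m ^ n) *\<^sub>C x)" for n
        using m(1) by (simp add: pow scaleC_one)
      then have "x \<in> V" unfolding V_def by blast
      obtain y where y: "y \<in> V" "S y = m *\<^sub>C x" "norm y \<le> C * norm (m *\<^sub>C x)"
        using C(2)[OF closed_csubspaceD(5)[OF V \<open>x \<in> V\<close>]] by blast
      have "x - y \<in> V" by (rule closed_csubspaceD(4)[OF V \<open>x \<in> V\<close> y(1)])
      moreover have "S (x - y) = 0" by (simp add: lin x(2) y(2))
      ultimately have "x - y = 0" using False by blast
      then have "norm x \<le> (C * cmod m) * norm x"
        using y(3) by (simp add: norm_scaleC mult.assoc)
      moreover have "C * cmod m < 1" using m C(1) by (simp add: field_simps)
      ultimately have "norm x < norm x"
        using x(1) mult_strict_right_mono[of "C * cmod m" 1 "norm x"] by simp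
      then show False by simp
    qed
    then show ?thesis using that[of "1 / C"] C(1) by simp
  qed
qed


section \<open>Operators that are not upper semi-Fredholm\<close>

text \<open>
  A bounded sequence without convergent subsequence has a range that is not totally bounded, so
  it has a uniformly separated subsequence.
\<close>

lemma not_upper_semi_fredholmE:
  fixes S :: "'a::complex_banach \<Rightarrow> 'a"
  assumes "\<not> upper_semi_fredholm S"
  obtains x :: "nat \<Rightarrow> 'a" and B d where "\<And>n. norm (x n) \<le> B" "d > 0"
    "\<And>i j. i < j \<Longrightarrow> d \<le> norm (x i - x j)" "Cauchy (\<lambda>n. S (x n))"
proof -
  obtain y :: "nat \<Rightarrow> 'a" where y: "bounded (range y)" "convergent (\<lambda>n. S (y n))"
    and no: "\<And>r :: nat \<Rightarrow> nat. strict_mono r \<Longrightarrow> \<not> convergent (y \<circ> r)"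
    using assms unfolding upper_semi_fredholm_def by blast
  have "\<not> compact (closure (range y))"
  proof
    assume "compact (closure (range y))"
    then have "seq_compact (closure (range y))" by (simp only: compact_eq_seq_compact_metric)
    moreover have "\<forall>n. y n \<in> closure (range y)" by (auto intro: subsetD[OF closure_subset])
    ultimately obtain l and r :: "nat \<Rightarrow> nat" where "strict_mono r" "(y \<circ> r) \<longlonglongrightarrow> l"
      by (rule seq_compactE)
    then show False using no[of r] convergentI[of "y \<circ> r" l] by simp
  qed
  then have "\<not> (\<forall>e>0. \<exists>k. finite k \<and> closure (range y) \<subseteq> (\<Union>x\<in>k. ball x e))"
    by (simp add: compact_eq_totally_bounded complete_eq_closed)
  then obtain e where e: "e > 0" "\<And>k. finite k \<Longrightarrow> \<not> closure (range y) \<subseteq> (\<Union>x\<in>k. ball x e)"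
    by blast
  have "\<exists>n. m < n \<and> (\<forall>i\<le>m. e / 2 \<le> dist (y i) (y n))" for m
  proof (rule ccontr)
    assume neg: "\<not> ?thesis"
    have "y n \<in> (\<Union>x\<in>y ` {..m}. cball x (e / 2))" for n
    proof (cases "n \<le> m")
      case True
      have "y n \<in> cball (y n) (e / 2)" using e(1) by simp
      with True show ?thesis by blast
    next
      case False
      then obtain i where "i \<le> m" "dist (y i) (y n) < e / 2" using neg by (meson not_le)
      then have "y n \<in> cball (y i) (e / 2)" by simp
      with \<open>i \<le> m\<close> show ?thesis by blast
    qed
    then have "closure (range y) \<subseteq> (\<Union>x\<in>y ` {..m}. cball x (e / 2))"
      by (intro closure_minimal closed_UN) auto
    also have "\<dots> \<subseteq> (\<Union>x\<in>y ` {..m}. ball x e)" using e(1) by force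
    finally show False using e(2)[of "y ` {..m}"] by blast
  qed
  then obtain g where g: "\<And>m. m < g m" "\<And>m i. i \<le> m \<Longrightarrow> e / 2 \<le> dist (y i) (y (g m))"
    by metis
  define r where "r k = (g ^^ k) 0" for k
  have rS: "r (Suc k) = g (r k)" for k by (simp add: r_def)
  have r: "strict_mono r" by (rule strict_monoI_Suc) (simp add: rS g(1))
  have sep: "e / 2 \<le> norm ((y \<circ> r) i - (y \<circ> r) j)" if ij: "i < j" for i j
  proof -
    obtain k where k: "j = Suc k" "i \<le> k" using ij by (cases j) auto
    have "r i \<le> r k" using strict_mono_mono[OF r] k(2) by (rule monoD)
    from g(2)[OF this] show ?thesis by (simp add: k(1) rS dist_norm)
  qed
  obtain B where B: "\<And>n. norm (y n) \<le> B" using y(1) by (auto simp: bounded_iff)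
  have "Cauchy ((\<lambda>n. S (y n)) \<circ> r)"
    by (rule Cauchy_subseq_Cauchy[OF convergent_Cauchy[OF y(2)] r])
  then have "Cauchy (\<lambda>n. S ((y \<circ> r) n))" by (simp add: o_def)
  then show ?thesis
    by (intro that[of "y \<circ> r" B "e / 2"]) (use B e(1) sep in auto)
qed

text \<open>
  In the classical construction of basic sequences, a vector annihilated by finitely many norming
  functionals plays the role of this difference.  Suppose that for all \<open>N \<le> i < j\<close> some
  \<open>f + t *\<^sub>C (x i - x j)\<close> with \<open>f \<in> K\<close> is shorter than \<open>c\<close>.  By compactness finitely many pairs
  \<open>(g, s)\<close> suffice up to a small error, and by Ramsey's theorem a single one of them makes
  \<open>g + s *\<^sub>C (x i - x j)\<close> have norm at most \<open>c' < 1\<close> for all \<open>i < j\<close> in an infinite set.  The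
  average of these vectors along a long chain of indices telescopes to a vector close to \<open>g\<close>, which
  has norm \<open>1\<close>.
\<close>

lemma exists_difference_nearly_preserving_norm:
  fixes x :: "nat \<Rightarrow> 'a::complex_banach"
  assumes K: "compact K" "\<And>f. f \<in> K \<Longrightarrow> norm f = 1" and B: "\<And>n. norm (x n) \<le> B" and c: "c < 1"
  obtains i j where "N \<le> i" "i < j"
    "\<And>f t. f \<in> K \<Longrightarrow> cmod t \<le> R \<Longrightarrow> c \<le> norm (f + t *\<^sub>C (x i - x j))"
proof (rule ccontr)
  assume neg: "\<not> thesis"
  note found = that
  have B0: "0 \<le> B" using B[of 0] norm_ge_zero order_trans by blast
  have diff: "norm (x i - x j) \<le> 2 * B" for i j
    using norm_triangle_ineq4[of "x i" "x j"] B[of i] B[of j] by linarith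
  \<comment> \<open>moving \<open>(f, t)\<close> by less than \<open>e\<close> changes the norm by at most \<open>e * (1 + 2 * B) = c' - c\<close>\<close>
  define e where "e = (1 - c) / 2 / (1 + 2 * B)"
  have e: "e > 0" using c B0 by (simp add: e_def)
  define c' where "c' = (1 + c) / 2"
  have c': "c' < 1" using c by (simp add: c'_def)
  have "seq_compact (K \<times> cball (0::complex) R)"
    using compact_Times[OF K(1) compact_cball] by (simp only: compact_eq_seq_compact_metric)
  from seq_compact_imp_totally_bounded[OF this, rule_format, OF e]
  obtain G where G: "finite G" "G \<subseteq> K \<times> cball (0::complex) R"
    "K \<times> cball 0 R \<subseteq> (\<Union>p\<in>G. ball p e)" by (elim exE conjE)
  have "\<exists>p\<in>G. norm (fst p + snd p *\<^sub>C (x i - x j)) \<le> c'" if ij: "N \<le> i" "i < j" for i j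
  proof -
    have "\<exists>f t. f \<in> K \<and> cmod t \<le> R \<and> norm (f + t *\<^sub>C (x i - x j)) < c"
    proof (rule ccontr)
      assume "\<not> ?thesis"
      then have "\<And>f t. f \<in> K \<Longrightarrow> cmod t \<le> R \<Longrightarrow> c \<le> norm (f + t *\<^sub>C (x i - x j))"
        by (meson not_le)
      from found[OF ij this] neg show False by blast
    qed
    then obtain f t where f: "f \<in> K" "cmod t \<le> R" "norm (f + t *\<^sub>C (x i - x j)) < c" by blast
    then have "(f, t) \<in> K \<times> cball 0 R" by simp
    then have "(f, t) \<in> (\<Union>p\<in>G. ball p e)" by (rule subsetD[OF G(3)])
    then obtain p where p: "p \<in> G" "dist p (f, t) < e" by (auto simp del: dist_Pair_Pair)
    have d: "dist (fst p) f < e" "dist (snd p) t < e"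
      using dist_fst_le[of p "(f, t)"] dist_snd_le[of p "(f, t)"] p(2) by simp_all
    have "fst p + snd p *\<^sub>C (x i - x j) =
        (f + t *\<^sub>C (x i - x j)) + ((fst p - f) + (snd p - t) *\<^sub>C (x i - x j))"
      by (simp add: complex_vector.scale_left_diff_distrib)
    then have "norm (fst p + snd p *\<^sub>C (x i - x j)) \<le>
        norm (f + t *\<^sub>C (x i - x j)) + (norm (fst p - f) + norm ((snd p - t) *\<^sub>C (x i - x j)))"
      by (metis norm_triangle_le norm_triangle_ineq add_left_mono)
    also have "\<dots> \<le> c + (e + e * (2 * B))"
      using d f(3) mult_mono[of "cmod (snd p - t)" e "norm (x i - x j)" "2 * B"] diff[of i j] e
      by (intro add_mono) (simp_all add: norm_scaleC dist_norm)
    also have "\<dots> = c + e * (1 + 2 * B)" by (simp add: algebra_simps)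
    also have "\<dots> = c'" using B0 by (simp add: e_def c'_def field_simps)
    finally show ?thesis using p(1) by blast
  qed
  then obtain P where P: "\<And>i j. N \<le> i \<Longrightarrow> i < j \<Longrightarrow>
      P i j \<in> G \<and> norm (fst (P i j) + snd (P i j) *\<^sub>C (x i - x j)) \<le> c'" by metis
  obtain h where h: "bij_betw h G {0..<card G}" using ex_bij_betw_finite_nat[OF G(1)] by blast
  define col where "col A = h (P (Min A) (Max A))" for A
  have col: "col {i, j} = h (P i j)" if "i < j" for i j
    using that by (simp add: col_def min_def max_def)
  have "\<forall>i\<in>{N..}. \<forall>j\<in>{N..}. i \<noteq> j \<longrightarrow> col {i, j} < card G"
  proof (intro ballI impI)
    have lt: "col {i, j} < card G" if "N \<le> i" "i < j" for i j
      using P[OF that] bij_betwE[OF h] by (simp add: col[OF that(2)])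
    fix i j assume "i \<in> {N..}" "j \<in> {N..}" "i \<noteq> j"
    then show "col {i, j} < card G"
      using lt[of i j] lt[of j i] by (cases "i < j") (auto simp: insert_commute)
  qed
  from Ramsey2[OF infinite_Ici this] obtain Y k where
    Yk: "Y \<subseteq> {N..} \<and> infinite Y \<and> k < card G \<and> (\<forall>i\<in>Y. \<forall>j\<in>Y. i \<noteq> j \<longrightarrow> col {i, j} = k)"
    by (elim exE)
  then have Y: "Y \<subseteq> {N..}" "infinite Y"
    and k: "\<And>i j. i \<in> Y \<Longrightarrow> j \<in> Y \<Longrightarrow> i \<noteq> j \<Longrightarrow> col {i, j} = k"
    by simp_all
  define r where "r = enumerate Y"
  have r: "strict_mono r" "\<And>n. r n \<in> Y"
    using Y(2) by (auto simp: r_def enumerate_in_set strict_mono_enumerate)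
  define p where "p = P (r 0) (r 1)"
  have Nr: "N \<le> r n" for n using r(2) Y(1) by auto
  have rlt: "r n < r (Suc n)" for n using r(1) by (rule strict_monoD) simp
  have pG: "p \<in> G" using P[OF Nr, of 0 "r 1"] rlt[of 0] by (simp add: p_def)
  have p: "P (r n) (r (Suc n)) = p" for n
  proof -
    have "h (P (r n) (r (Suc n))) = k" for n
      using k[OF r(2) r(2), of n "Suc n"] col[OF rlt] rlt[of n] by simp
    from this[of n] this[of 0] have "h (P (r n) (r (Suc n))) = h p" by (simp add: p_def)
    then show ?thesis
      using bij_betw_imp_inj_on[OF h] P[OF Nr rlt] pG by (meson inj_onD)
  qed
  obtain g s where gs: "p = (g, s)" by (cases p)
  have g: "norm g = 1" "cmod s \<le> R" using pG G(2) K(2) gs by auto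
  have bound: "real M * (1 - c') \<le> R * (2 * B)" for M
  proof -
    have s1: "norm (\<Sum>n<M. g + s *\<^sub>C (x (r n) - x (r (Suc n)))) \<le> real M * c'"
    proof -
      have "norm (g + s *\<^sub>C (x (r n) - x (r (Suc n)))) \<le> c'" for n
        using P[OF Nr rlt, of n] by (simp add: p gs)
      then show ?thesis
        using sum_norm_bound[of "{..<M}" "\<lambda>n. g + s *\<^sub>C (x (r n) - x (r (Suc n)))" c'] by simp
    qed
    have s2: "(\<Sum>n<M. g + s *\<^sub>C (x (r n) - x (r (Suc n)))) = real M *\<^sub>R g + s *\<^sub>C (x (r 0) - x (r M))"
      by (simp add: sum.distrib sum_constant_scaleR sum_lessThan_telescope'[of "\<lambda>n. x (r n)"]
          flip: complex_vector.scale_sum_right)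
    have "norm (real M *\<^sub>R g) \<le>
        norm (real M *\<^sub>R g + s *\<^sub>C (x (r 0) - x (r M))) + norm (s *\<^sub>C (x (r 0) - x (r M)))"
      by (metis add_diff_cancel_right' norm_triangle_ineq4)
    moreover have "norm (s *\<^sub>C (x (r 0) - x (r M))) \<le> R * (2 * B)"
      unfolding norm_scaleC by (rule mult_mono) (use g diff order_trans[OF norm_ge_zero g(2)] in auto)
    ultimately have "real M \<le> real M * c' + R * (2 * B)"
      using s1[unfolded s2] g(1) by simp
    then show ?thesis by (simp add: right_diff_distrib)
  qed
  obtain M where "R * (2 * B) / (1 - c') < real M" using reals_Archimedean2 by blast
  then have "R * (2 * B) < real M * (1 - c')" using c' by (simp add: field_simps)
  with bound[of M] show False by simp
qed


text \<open>
  The weights \<open>1 - (1/2)\<^sup>k\<^sup>+\<^sup>1\<close> increase from \<open>1/2\<close> to \<open>1\<close>.  Letting the weighted norms of the partial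
  sums increase bounds all partial sums by twice the norm of the full sum, while every single step
  has room for a small loss.
\<close>

definition basis_weight :: "nat \<Rightarrow> real" where
  "basis_weight k = 1 - (1 / 2) ^ Suc k"

lemma basis_weight: "1 / 2 \<le> basis_weight k" "basis_weight k < 1"
    "basis_weight k < basis_weight (Suc k)"
proof -
  have "(1 / 2 :: real) ^ k \<le> 1" by (rule power_le_one) auto
  then show "1 / 2 \<le> basis_weight k" by (simp add: basis_weight_def)
  show "basis_weight k < 1" "basis_weight k < basis_weight (Suc k)"
    by (simp_all add: basis_weight_def)
qed

text \<open>
  The unit vector \<open>v\<close> can be the next member of a basic sequence that begins with
  \<open>u 0, \<dots>, u (k - 1)\<close>.
\<close>

definition extends_basic :: "(nat \<Rightarrow> 'a::complex_banach) \<Rightarrow> nat \<Rightarrow> 'a \<Rightarrow> bool" where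
  "extends_basic u k v \<longleftrightarrow> norm v = 1 \<and>
    (\<forall>c t. basis_weight k * norm (\<Sum>i<k. c i *\<^sub>C u i) \<le>
      basis_weight (Suc k) * norm ((\<Sum>i<k. c i *\<^sub>C u i) + t *\<^sub>C v))"

lemma extends_basic_cong:
  "(\<And>i. i < k \<Longrightarrow> u i = u' i) \<Longrightarrow> extends_basic u k v \<longleftrightarrow> extends_basic u' k v"
  by (simp add: extends_basic_def)

lemma extends_basic_partial_sum:
  assumes "\<And>i. i < n \<Longrightarrow> extends_basic u i (u i)" "k \<le> n"
  shows "norm (\<Sum>i<k. c i *\<^sub>C u i) \<le> 2 * norm (\<Sum>i<n. c i *\<^sub>C u i)"
proof -
  let ?p = "\<lambda>m. norm (\<Sum>i<m. c i *\<^sub>C u i)"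
  have "basis_weight k * ?p k \<le> basis_weight n * ?p n"
    using assms(2,1)
  proof (induction n rule: dec_induct)
    case (step m)
    have "basis_weight k * ?p k \<le> basis_weight m * ?p m" using step by simp
    also have "\<dots> \<le> basis_weight (Suc m) * norm ((\<Sum>i<m. c i *\<^sub>C u i) + c m *\<^sub>C u m)"
      using step.prems[of m] by (simp only: extends_basic_def lessI)
    finally show ?case by simp
  qed simp
  moreover have "1 / 2 * ?p k \<le> basis_weight k * ?p k"
    by (rule mult_right_mono[OF basis_weight(1)]) simp
  moreover have "basis_weight n * ?p n \<le> 1 * ?p n"
    by (rule mult_right_mono) (use basis_weight(2)[of n] in auto)
  ultimately show ?thesis by simp
qed

lemma extends_basic_coefficient:
  assumes u: "\<And>i. i < n \<Longrightarrow> extends_basic u i (u i)" and k: "k < n"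
  shows "cmod (c k) \<le> 4 * norm (\<Sum>i<n. c i *\<^sub>C u i)"
proof -
  let ?p = "\<lambda>m. \<Sum>i<m. c i *\<^sub>C u i"
  have "norm (u k) = 1" using u[OF k] by (simp add: extends_basic_def)
  then have "cmod (c k) = norm (?p (Suc k) - ?p k)" by (simp add: norm_scaleC)
  also have "\<dots> \<le> norm (?p (Suc k)) + norm (?p k)" by (rule norm_triangle_ineq4)
  also have "\<dots> \<le> 2 * norm (?p n) + 2 * norm (?p n)"
    using k by (intro add_mono extends_basic_partial_sum u) auto
  finally show ?thesis by simp
qed

text \<open>
  With the bound on coefficients this yields the compactness of the unit spheres of the spans of
  initial segments.
\<close>

lemma compact_combinations:
  fixes u :: "nat \<Rightarrow> 'a::complex_normed_vector"
  shows "compact {\<Sum>i<k. c i *\<^sub>C u i | c. \<forall>i<k. cmod (c i) \<le> r}"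
proof (induction k)
  case (Suc k)
  let ?A = "\<lambda>k. {\<Sum>i<k. c i *\<^sub>C u i | c. \<forall>i<k. cmod (c i) \<le> r}"
  have "continuous_on (?A k \<times> cball 0 r) (\<lambda>p. fst p + snd p *\<^sub>C u k)"
    unfolding continuous_on_def
    by (intro ballI tendsto_add tendsto_scaleC tendsto_fst tendsto_snd tendsto_const tendsto_ident_at)
  then have "compact ((\<lambda>p. fst p + snd p *\<^sub>C u k) ` (?A k \<times> cball 0 r))"
    by (rule compact_continuous_image[OF _ compact_Times[OF Suc compact_cball]])
  moreover have "(\<lambda>p. fst p + snd p *\<^sub>C u k) ` (?A k \<times> cball 0 r) = ?A (Suc k)"
  proof (intro equalityI subsetI)
    fix y assume "y \<in> (\<lambda>p. fst p + snd p *\<^sub>C u k) ` (?A k \<times> cball 0 r)"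
    then obtain c t where c: "\<forall>i<k. cmod (c i) \<le> r" "cmod t \<le> r"
      "y = (\<Sum>i<k. c i *\<^sub>C u i) + t *\<^sub>C u k" by auto
    then have "y = (\<Sum>i<Suc k. (c(k := t)) i *\<^sub>C u i)" "\<forall>i<Suc k. cmod ((c(k := t)) i) \<le> r"
      by (auto simp: less_Suc_eq)
    then show "y \<in> ?A (Suc k)" by blast
  next
    fix y assume "y \<in> ?A (Suc k)"
    then obtain c where c: "\<forall>i<Suc k. cmod (c i) \<le> r" "y = (\<Sum>i<Suc k. c i *\<^sub>C u i)" by blast
    have "y = fst (\<Sum>i<k. c i *\<^sub>C u i, c k) + snd (\<Sum>i<k. c i *\<^sub>C u i, c k) *\<^sub>C u k"
      using c(2) by simp
    moreover have "(\<Sum>i<k. c i *\<^sub>C u i, c k) \<in> ?A k \<times> cball 0 r" using c(1) by auto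
    ultimately show "y \<in> (\<lambda>p. fst p + snd p *\<^sub>C u k) ` (?A k \<times> cball 0 r)" by (rule image_eqI)
  qed
  ultimately show ?case by simp
qed simp

text \<open>
  The new vector is a normalised difference of two late members of a separated sequence whose images
  converge: its image is small, and almost no norm is lost when multiples of it are added to the
  unit vectors in the span of the vectors already chosen.
\<close>

lemma not_upper_semi_fredholm_extend:
  fixes S :: "'a::complex_banach \<Rightarrow> 'a"
  assumes op: "complex_operator S" and nusf: "\<not> upper_semi_fredholm S" and e: "e > 0"
    and u: "\<And>i. i < k \<Longrightarrow> extends_basic u i (u i)"
  shows "\<exists>v. extends_basic u k v \<and> norm (S v) \<le> e"
proof -
  obtain x :: "nat \<Rightarrow> 'a" and B d where x: "\<And>n. norm (x n) \<le> B" "d > 0"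
    "\<And>i j. i < j \<Longrightarrow> d \<le> norm (x i - x j)" "Cauchy (\<lambda>n. S (x n))"
    using not_upper_semi_fredholmE[OF nusf] by metis
  obtain N where N: "\<And>i j. N \<le> i \<Longrightarrow> N \<le> j \<Longrightarrow> norm (S (x i) - S (x j)) < e * d"
    using CauchyD[OF x(4), of "e * d"] e x(2) by (metis mult_pos_pos)
  define K where "K = {\<Sum>i<k. c i *\<^sub>C u i | c. \<forall>i<k. cmod (c i) \<le> 4} \<inter> {f. norm f = 1}"
  have "compact K"
    unfolding K_def
    by (intro compact_Int_closed compact_combinations closed_Collect_eq continuous_intros)
  moreover have "norm f = 1" if "f \<in> K" for f using that by (simp add: K_def)
  ultimately have K: "compact K" "\<And>f. f \<in> K \<Longrightarrow> norm f = 1" by blast+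
  define q where "q = basis_weight k / basis_weight (Suc k)"
  have w: "0 < basis_weight k" "0 < basis_weight (Suc k)"
    using basis_weight(1)[of k] basis_weight(1)[of "Suc k"] by linarith+
  have q: "q < 1" using basis_weight(3)[of k] w by (simp add: q_def)
  \<comment> \<open>a unit vector is not shortened by adding a multiple of \<open>v\<close> with coefficient larger than \<open>2\<close>;
    as \<open>v\<close> is a difference of norm at least \<open>d\<close>, normalised, smaller coefficients of \<open>v\<close> give
    coefficients of the difference up to \<open>2 / d\<close>\<close>
  obtain i j where ij: "N \<le> i" "i < j"
    and far: "\<And>f t. f \<in> K \<Longrightarrow> cmod t \<le> 2 / d \<Longrightarrow> q \<le> norm (f + t *\<^sub>C (x i - x j))"
    using exists_difference_nearly_preserving_norm[of K x B q N "2 / d", OF K x(1) q] by blast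
  define y where "y = x i - x j"
  have y: "d \<le> norm y" using x(3)[OF ij(2)] by (simp add: y_def)
  then have y0: "0 < norm y" using x(2) by linarith
  define a where "a = complex_of_real (inverse (norm y))"
  have a: "cmod a = inverse (norm y)" by (simp add: a_def norm_inverse)
  define v where "v = a *\<^sub>C y"
  have v: "norm v = 1" using y0 by (simp add: v_def norm_scaleC a)
  have "norm (S y) \<le> e * d" using N[of i j] ij by (simp add: y_def complex_operatorD(4)[OF op])
  also have "\<dots> \<le> e * norm y" using y e by simp
  finally have "norm (S v) \<le> e"
    using y0 by (simp add: v_def complex_operatorD(2)[OF op] norm_scaleC a field_simps)
  moreover have "basis_weight k * norm f \<le> basis_weight (Suc k) * norm (f + t *\<^sub>C v)"
    if f: "f = (\<Sum>i<k. c i *\<^sub>C u i)" for f c t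
  proof (cases "f = 0")
    case True
    then show ?thesis using w by simp
  next
    case False
    define r where "r = norm f"
    have r: "r > 0" using False by (simp add: r_def)
    have "q * r \<le> norm (f + t *\<^sub>C v)"
    proof (cases "cmod t \<le> 2 * r")
      case True
      define b where "b = complex_of_real (inverse r)"
      have b: "cmod b = inverse r" using r by (simp add: b_def norm_inverse)
      define g where "g = b *\<^sub>C f"
      have g: "g = (\<Sum>i<k. (b * c i) *\<^sub>C u i)"
        unfolding g_def f complex_vector.scale_sum_right by (simp add: scaleC_scaleC)
      have g1: "norm g = 1" using r by (simp add: g_def norm_scaleC b flip: r_def)
      have "cmod (b * c i) \<le> 4" if i: "i < k" for i
        using extends_basic_coefficient[of k u i "\<lambda>i. b * c i", OF u i] g g1 by simp
      then have "\<exists>c'. g = (\<Sum>i<k. c' i *\<^sub>C u i) \<and> (\<forall>i<k. cmod (c' i) \<le> 4)"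
        using g by (intro exI[of _ "\<lambda>i. b * c i"]) simp
      then have "g \<in> K" using g1 by (simp add: K_def)
      have "cmod t * inverse r \<le> 2" using True r by (simp add: field_simps)
      moreover have "inverse (norm y) \<le> inverse d" using y x(2) by (rule le_imp_inverse_le)
      ultimately have "cmod t * inverse r * inverse (norm y) \<le> 2 * inverse d"
        using y0 r by (intro mult_mono) auto
      then have "cmod (t * b * a) \<le> 2 / d" by (simp add: norm_mult a b divide_inverse)
      from far[OF \<open>g \<in> K\<close> this] have "q \<le> norm (g + (t * b * a) *\<^sub>C y)"
        by (simp only: y_def)
      also have "g + (t * b * a) *\<^sub>C y = b *\<^sub>C (f + t *\<^sub>C v)"
        unfolding g_def v_def complex_vector.scale_right_distrib scaleC_scaleC by (simp only: mult_ac)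
      also have "norm \<dots> = inverse r * norm (f + t *\<^sub>C v)" by (simp add: norm_scaleC b)
      finally show ?thesis using r by (simp add: field_simps)
    next
      case False
      have "norm (t *\<^sub>C v) \<le> norm (f + t *\<^sub>C v) + norm f"
        using norm_triangle_ineq4[of "f + t *\<^sub>C v" f] by simp
      then have "r \<le> norm (f + t *\<^sub>C v)" using False v by (simp add: norm_scaleC r_def)
      moreover have "q * r \<le> 1 * r" using q r by (intro mult_right_mono) auto
      ultimately show ?thesis by simp
    qed
    then show ?thesis using w by (simp add: q_def r_def field_simps)
  qed
  ultimately show ?thesis using v by (auto simp: extends_basic_def)
qed

lemma infinite_dim_mono:
  assumes "Y \<subseteq> E" "complex_vector.subspace Y" "infinite_dim Y"
  shows "infinite_dim E"
  unfolding infinite_dim_def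
proof
  assume "\<exists>B. finite B \<and> complex_vector.span B = E"
  then obtain B where B: "finite B" "complex_vector.span B = E" by blast
  obtain B' where B': "B' \<subseteq> Y" "complex_vector.independent B'" "Y \<subseteq> complex_vector.span B'"
    using complex_vector.maximal_independent_subset by blast
  have "finite B'"
    using complex_vector.independent_span_bound[OF B(1) B'(2)] B'(1) assms(1) B(2) by blast
  moreover have "complex_vector.span B' = Y"
    using B' complex_vector.span_minimal[OF B'(1) assms(2)] by blast
  ultimately show False using assms(3) by (auto simp: infinite_dim_def)
qed

text \<open>
  In the constructed basic sequence, the coefficients of \<open>y\<close> are at most \<open>4 * norm y\<close>, while the
  norms of the images of the basis vectors add up to at most \<open>e / 4\<close>.
\<close>

lemma not_upper_semi_fredholm_small_on_subspace:
  fixes S :: "'a::complex_banach \<Rightarrow> 'a"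
  assumes op: "complex_operator S" and nusf: "\<not> upper_semi_fredholm S" and e: "e > 0"
  obtains Y where "closed_csubspace Y" "infinite_dim Y" "\<And>y. y \<in> Y \<Longrightarrow> norm (S y) \<le> e * norm y"
proof -
  have "\<exists>u. \<forall>k. extends_basic u k (u k) \<and> norm (S (u k)) \<le> e / 8 * (1 / 2) ^ k"
  proof (rule dependent_wellorder_choice)
    show "(extends_basic f k r \<and> norm (S r) \<le> e / 8 * (1 / 2) ^ k) =
        (extends_basic g k r \<and> norm (S r) \<le> e / 8 * (1 / 2) ^ k)"
      if "\<And>i. i < k \<Longrightarrow> f i = g i" for r k and f g :: "nat \<Rightarrow> 'a"
      using extends_basic_cong[of k f g r] that by blast
    show "\<exists>r. extends_basic f k r \<and> norm (S r) \<le> e / 8 * (1 / 2) ^ k"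
      if "\<And>i. i < k \<Longrightarrow> extends_basic f i (f i) \<and> norm (S (f i)) \<le> e / 8 * (1 / 2) ^ i" for k f
      using that e by (intro not_upper_semi_fredholm_extend[OF op nusf]) auto
  qed
  then obtain u where u: "\<And>k. extends_basic u k (u k)"
    "\<And>k. norm (S (u k)) \<le> e / 8 * (1 / 2) ^ k" by metis
  note lin = complex_operatorD[OF op]
  have coeff: "cmod (c k) \<le> 4 * norm (\<Sum>i<n. c i *\<^sub>C u i)" if "k < n" for c k n
    using u(1) that by (rule extends_basic_coefficient)
  have "inj u"
  proof (rule linorder_injI)
    fix i j :: nat assume "i < j"
    show "u i \<noteq> u j"
    proof
      assume "u i = u j"
      define c where "c k = (if k = i then 1 else if k = j then - 1 else 0 :: complex)" for k
      have "(\<Sum>k<Suc j. c k *\<^sub>C u k) = (\<Sum>k\<in>{i, j}. c k *\<^sub>C u k)"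
        using \<open>i < j\<close> by (intro sum.mono_neutral_right) (auto simp: c_def)
      also have "\<dots> = 0" using \<open>i < j\<close> \<open>u i = u j\<close> by (simp add: c_def scaleC_one)
      finally have "cmod (c i) \<le> 0" using coeff[of i "Suc j" c] \<open>i < j\<close> by simp
      then show False by (simp add: c_def)
    qed
  qed
  have comb: "\<exists>n c. (\<Sum>v\<in>t. r v *\<^sub>C v) = (\<Sum>i<n. c i *\<^sub>C u i) \<and> (\<forall>v\<in>t. \<exists>i<n. c i = r v)"
    if t: "finite t" "t \<subseteq> range u" for t r
  proof -
    obtain I where I: "finite I" "t = u ` I" using finite_subset_image[OF t] by blast
    obtain n where n: "I \<subseteq> {..<n}" using finite_nat_bounded[OF I(1)] by blast
    define c where "c i = (if i \<in> I then r (u i) else 0)" for i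
    have "(\<Sum>v\<in>t. r v *\<^sub>C v) = (\<Sum>i\<in>I. r (u i) *\<^sub>C u i)"
      unfolding I(2) by (rule sum.reindex_cong[OF inj_on_subset[OF \<open>inj u\<close>]]) auto
    also have "\<dots> = (\<Sum>i<n. c i *\<^sub>C u i)"
      using n by (intro sum.mono_neutral_cong_left) (auto simp: c_def)
    finally show ?thesis using n I(2) by (intro exI[of _ n] exI[of _ c]) (auto simp: c_def)
  qed
  have indep: "complex_vector.independent (range u)"
    unfolding complex_vector.dependent_explicit
  proof clarify
    fix t r v assume t: "finite t" "t \<subseteq> range u" "(\<Sum>v\<in>t. r v *\<^sub>C v) = 0" "v \<in> t" "r v \<noteq> 0"
    from comb[OF t(1,2), of r] obtain n c
      where c: "(\<Sum>v\<in>t. r v *\<^sub>C v) = (\<Sum>i<n. c i *\<^sub>C u i)" "\<forall>v\<in>t. \<exists>i<n. c i = r v" by blast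
    then obtain i where "i < n" "c i = r v" using t(4) by blast
    with coeff[of i n c] c(1) t(3,5) show False by simp
  qed
  have bound: "norm (S y) \<le> e * norm y" if y: "y \<in> complex_vector.span (range u)" for y
  proof -
    obtain t r where t: "finite t" "t \<subseteq> range u" "y = (\<Sum>v\<in>t. r v *\<^sub>C v)"
      using y unfolding complex_vector.span_explicit by blast
    with comb[OF t(1,2), of r] obtain n c where c: "y = (\<Sum>i<n. c i *\<^sub>C u i)" by metis
    have "S y = (\<Sum>i<n. c i *\<^sub>C S (u i))"
      by (simp add: c linear_sum[OF bounded_linear.linear[OF lin(1)]] lin(2))
    also have "norm \<dots> \<le> (\<Sum>i<n. (4 * norm y) * (e / 8 * (1 / 2) ^ i))"
    proof (rule sum_norm_le)
      fix i assume "i \<in> {..<n}"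
      then have "cmod (c i) \<le> 4 * norm y" unfolding c by (intro coeff) simp
      then show "norm (c i *\<^sub>C S (u i)) \<le> (4 * norm y) * (e / 8 * (1 / 2) ^ i)"
        unfolding norm_scaleC by (rule mult_mono[OF _ u(2)]) auto
    qed
    also have "\<dots> = (e / 2 * norm y) * (\<Sum>i<n. (1 / 2) ^ i)"
      by (simp add: sum_distrib_left mult_ac)
    also have "\<dots> \<le> (e / 2 * norm y) * 2"
      using e by (intro mult_left_mono) (simp_all add: geometric_sum)
    finally show ?thesis by simp
  qed
  define Y where "Y = closure (complex_vector.span (range u))"
  have "closed_csubspace Y"
    unfolding Y_def by (rule closed_csubspace_closure) (rule complex_vector.subspace_span)
  moreover have "infinite_dim Y"
    unfolding infinite_dim_def
  proof
    assume "\<exists>B. finite B \<and> complex_vector.span B = Y"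
    then obtain B where B: "finite B" "complex_vector.span B = Y" by blast
    have "range u \<subseteq> complex_vector.span B"
      unfolding B(2) Y_def by (rule order_trans[OF complex_vector.span_superset closure_subset])
    from complex_vector.independent_span_bound[OF B(1) indep this]
    have "finite (range u)" by (rule conjunct1)
    from finite_imageD[OF this \<open>inj u\<close>] show False by simp
  qed
  moreover have "norm (S y) \<le> e * norm y" if "y \<in> Y" for y
  proof -
    have "closed {y. norm (S y) \<le> e * norm y}"
      by (intro closed_Collect_le continuous_intros linear_continuous_on lin(1))
    then have "Y \<subseteq> {y. norm (S y) \<le> e * norm y}"
      unfolding Y_def by (intro closure_minimal subsetI CollectI bound)
    then show ?thesis using that by blast
  qed
  ultimately show ?thesis using that by blast
qed


section \<open>Operators on hereditarily indecomposable spaces\<close>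

text \<open>
  For \<open>y\<close> almost an eigenvector for \<open>l\<close> and \<open>z\<close> almost an eigenvector for \<open>m\<close>, the operator
  \<open>T - m\<close> maps \<open>y + z\<close> approximately to \<open>(l - m) y\<close>, so \<open>y + z\<close> cannot be small compared to \<open>y\<close>.
\<close>

lemma almost_eigenspaces_direct_sum:
  fixes T :: "'a::complex_banach \<Rightarrow> 'a"
  assumes op: "complex_operator T" and lm: "l \<noteq> m"
    and Y: "closed_csubspace Y" "\<And>y. y \<in> Y \<Longrightarrow> norm (T y - l *\<^sub>C y) \<le> cmod (l - m) / 4 * norm y"
    and Z: "closed_csubspace Z" "\<And>z. z \<in> Z \<Longrightarrow> norm (T z - m *\<^sub>C z) \<le> cmod (l - m) / 4 * norm z"
  shows "Y \<inter> Z = {0}" "closed_csubspace {y + z | y z. y \<in> Y \<and> z \<in> Z}"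
proof -
  define d where "d = cmod (l - m)"
  have d: "d > 0" using lm by (simp add: d_def)
  note lin = complex_operatorD[OF op]
  note opm = complex_operator_minus_scaleC[OF op, of m]
  obtain M where M: "M > 0" "\<And>x. norm (T x - m *\<^sub>C x) \<le> norm x * M"
    using bounded_linear.pos_bounded[OF complex_operatorD(1)[OF opm]] by blast
  define C where "C = 2 * (M + d) / d"
  have angle: "norm y \<le> C * norm (y + z)" if yz: "y \<in> Y" "z \<in> Z" for y z
  proof -
    define w where "w = y + z"
    have "(l - m) *\<^sub>C y = (T w - m *\<^sub>C w) - (T y - l *\<^sub>C y) - (T z - m *\<^sub>C z)"
      by (simp add: w_def lin(3) complex_vector.scale_right_distrib complex_vector.scale_left_diff_distrib)
    then have "norm ((l - m) *\<^sub>C y) \<le>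
        norm (T w - m *\<^sub>C w) + norm (T y - l *\<^sub>C y) + norm (T z - m *\<^sub>C z)"
      using norm_triangle_ineq4[of "(T w - m *\<^sub>C w) - (T y - l *\<^sub>C y)" "T z - m *\<^sub>C z"]
        norm_triangle_ineq4[of "T w - m *\<^sub>C w" "T y - l *\<^sub>C y"] by simp
    also have "\<dots> \<le> norm w * M + d / 4 * norm y + d / 4 * norm z"
      using M(2)[of w] Y(2)[OF yz(1)] Z(2)[OF yz(2)] by (simp add: d_def)
    finally have "d * norm y \<le> norm w * M + d / 4 * norm y + d / 4 * norm z"
      by (simp add: norm_scaleC d_def)
    moreover have "d / 4 * norm z \<le> d / 4 * (norm w + norm y)"
      using norm_triangle_ineq4[of w y] d by (intro mult_left_mono) (simp_all add: w_def)
    ultimately have "d * norm y \<le> norm w * M + d / 2 * norm y + d / 4 * norm w"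
      by (simp add: algebra_simps)
    then have "d * norm y \<le> 2 * (norm w * M) + d / 2 * norm w" by simp
    moreover have "d / 2 * norm w \<le> 2 * d * norm w" using d by (intro mult_right_mono) auto
    ultimately have "d * norm y \<le> 2 * (M + d) * norm w" by (simp add: algebra_simps)
    then show ?thesis using d by (simp add: C_def w_def field_simps)
  qed
  show "Y \<inter> Z = {0}"
  proof (intro equalityI subsetI)
    fix y assume "y \<in> Y \<inter> Z"
    then have "y \<in> Y" "0 - y \<in> Z"
      using closed_csubspaceD(4)[OF Z(1) closed_csubspaceD(2)[OF Z(1)]] by blast+
    from angle[OF this] show "y \<in> {0}" by simp
  qed (use closed_csubspaceD(2)[OF Y(1)] closed_csubspaceD(2)[OF Z(1)] in auto)
  have "closed {y + z | y z. y \<in> Y \<and> z \<in> Z}"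
    unfolding closed_sequential_limits
  proof (intro allI impI)
    fix x w assume x: "(\<forall>n. x n \<in> {y + z | y z. y \<in> Y \<and> z \<in> Z}) \<and> x \<longlonglongrightarrow> w"
    then have "\<forall>n. \<exists>y z. y \<in> Y \<and> z \<in> Z \<and> x n = y + z" by blast
    then obtain y z where yz: "\<And>n. y n \<in> Y" "\<And>n. z n \<in> Z" "\<And>n. x n = y n + z n" by metis
    have C: "C > 0" using M(1) d by (simp add: C_def)
    have "Cauchy y"
    proof (rule CauchyI)
      fix e :: real assume "e > 0"
      then have "e / C > 0" using C by simp
      then obtain N where N: "\<And>i j. N \<le> i \<Longrightarrow> N \<le> j \<Longrightarrow> norm (x i - x j) < e / C"
        using CauchyD[OF LIMSEQ_imp_Cauchy[OF conjunct2[OF x]]] by metis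
      have "norm (y i - y j) < e" if ij: "N \<le> i" "N \<le> j" for i j
      proof -
        have "norm (y i - y j) \<le> C * norm ((y i - y j) + (z i - z j))"
          by (intro angle closed_csubspaceD(4)[OF Y(1)] closed_csubspaceD(4)[OF Z(1)] yz)
        also have "(y i - y j) + (z i - z j) = x i - x j" by (simp add: yz(3))
        also have "C * norm (x i - x j) < C * (e / C)"
          using N[OF ij] C by (intro mult_strict_left_mono)
        finally show ?thesis using C by simp
      qed
      then show "\<exists>N. \<forall>i\<ge>N. \<forall>j\<ge>N. norm (y i - y j) < e" by blast
    qed
    then obtain y' where y': "y \<longlonglongrightarrow> y'" using Cauchy_convergent convergent_def by blast
    have "(\<lambda>n. x n - y n) \<longlonglongrightarrow> w - y'" using x y' by (intro tendsto_diff) auto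
    then have "z \<longlonglongrightarrow> w - y'" by (simp add: yz(3))
    then have "w - y' \<in> Z"
      by (rule closed_sequentially[OF closed_csubspaceD(1)[OF Z(1)], rotated]) (rule yz(2))
    moreover have "y' \<in> Y"
      using y' by (rule closed_sequentially[OF closed_csubspaceD(1)[OF Y(1)], rotated]) (rule yz(1))
    moreover have "w = y' + (w - y')" by simp
    ultimately show "w \<in> {y + z | y z. y \<in> Y \<and> z \<in> Z}" by blast
  qed
  moreover have "complex_vector.subspace {y + z | y z. y \<in> Y \<and> z \<in> Z}"
    by (rule complex_vector.subspace_sums) (use Y(1) Z(1) in \<open>simp_all add: closed_csubspace_def\<close>)
  ultimately show "closed_csubspace {y + z | y z. y \<in> Y \<and> z \<in> Z}"
    by (simp add: closed_csubspace_def)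
qed

text \<open>
  Two exceptional points would produce two infinite-dimensional almost eigenspaces whose direct sum is
  a decomposable closed subspace.
\<close>

lemma hereditarily_indecomposable_fredholm:
  fixes T :: "'a::complex_banach \<Rightarrow> 'a"
  assumes hi: "hereditarily_indecomposable TYPE('a)" and op: "complex_operator T"
  obtains l0 where "\<And>l. l \<noteq> l0 \<Longrightarrow> upper_semi_fredholm (\<lambda>x. T x - l *\<^sub>C x)"
proof -
  have "l = m" if lm: "\<not> upper_semi_fredholm (\<lambda>x. T x - l *\<^sub>C x)"
      "\<not> upper_semi_fredholm (\<lambda>x. T x - m *\<^sub>C x)" for l m
  proof (rule ccontr)
    assume "l \<noteq> m"
    then have e: "cmod (l - m) / 4 > 0" by simp
    obtain Y where Y: "closed_csubspace Y" "infinite_dim Y"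
      "\<And>y. y \<in> Y \<Longrightarrow> norm (T y - l *\<^sub>C y) \<le> cmod (l - m) / 4 * norm y"
      using not_upper_semi_fredholm_small_on_subspace[OF complex_operator_minus_scaleC[OF op] lm(1) e]
      by metis
    obtain Z where Z: "closed_csubspace Z" "infinite_dim Z"
      "\<And>z. z \<in> Z \<Longrightarrow> norm (T z - m *\<^sub>C z) \<le> cmod (l - m) / 4 * norm z"
      using not_upper_semi_fredholm_small_on_subspace[OF complex_operator_minus_scaleC[OF op] lm(2) e]
      by metis
    define E where "E = {y + z | y z. y \<in> Y \<and> z \<in> Z}"
    note YZ = almost_eigenspaces_direct_sum[OF op \<open>l \<noteq> m\<close> Y(1,3) Z(1,3), folded E_def]
    have "Y \<subseteq> E"
    proof
      fix y assume "y \<in> Y"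
      then show "y \<in> E"
        unfolding E_def using closed_csubspaceD(2)[OF Z(1)]
        by (intro CollectI exI[of _ y] exI[of _ 0]) simp
    qed
    then have "infinite_dim E"
      using infinite_dim_mono Y(1,2) unfolding closed_csubspace_def by blast
    then have "\<not> decomposable E"
      using hi YZ(2) unfolding hereditarily_indecomposable_def by blast
    moreover have "decomposable E"
      unfolding decomposable_def using Y(1,2) Z(1,2) YZ(1) E_def by blast
    ultimately show False ..
  qed
  then show ?thesis using that by metis
qed

text \<open>
  Away from the exceptional point, the set of limit points of the point spectrum is closed, open by
  the alternative in punctured neighbourhoods, and without points of large modulus.  The punctured
  plane being connected, this set is empty.
\<close>

lemma countable_point_spectrum:
  fixes T :: "'a::complex_banach \<Rightarrow> 'a"
  assumes op: "complex_operator T"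
    and usf: "\<And>l. l \<noteq> l0 \<Longrightarrow> upper_semi_fredholm (\<lambda>x. T x - l *\<^sub>C x)"
  shows "countable (point_spectrum T)"
proof -
  let ?P = "point_spectrum T"
  define A where "A = {l. l islimpt ?P} - {l0}"
  have "open A"
    unfolding open_contains_ball
  proof
    fix l assume l: "l \<in> A"
    then have "l \<noteq> l0" and lim: "l islimpt ?P" by (auto simp: A_def)
    obtain r where r: "r > 0" and alt':
      "(\<forall>m. 0 < cmod m \<and> cmod m < r \<longrightarrow> m \<in> point_spectrum (\<lambda>x. T x - l *\<^sub>C x)) \<or>
       (\<forall>m. 0 < cmod m \<and> cmod m < r \<longrightarrow> m \<notin> point_spectrum (\<lambda>x. T x - l *\<^sub>C x))"
      by (rule upper_semi_fredholm_punctured_nbhd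
          [OF usf[OF \<open>l \<noteq> l0\<close>] complex_operator_minus_scaleC[OF op]])
    note alt = alt'[unfolded eigenvalue_minus_scaleC]
    obtain k where k: "k \<in> ?P" "k \<noteq> l" "dist k l < r"
      using lim r unfolding islimpt_approachable by blast
    have "l + (k - l) \<in> ?P" "0 < cmod (k - l)" "cmod (k - l) < r" using k by (simp_all add: dist_norm)
    with alt have nbhd: "l + m \<in> ?P" if "0 < cmod m" "cmod m < r" for m
      using that by blast
    define s where "s = min r (dist l l0)"
    have s: "s > 0" using r \<open>l \<noteq> l0\<close> by (simp add: s_def)
    have "k \<in> A" if k: "k \<in> ball l s" for k
    proof -
      have "ball l r \<subseteq> insert l ?P"
      proof
        fix m assume "m \<in> ball l r"
        then show "m \<in> insert l ?P"
          using nbhd[of "m - l"] by (cases "m = l") (simp_all add: dist_norm norm_minus_commute)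
      qed
      moreover have "k islimpt ball l r" using k r by (simp add: islimpt_ball s_def)
      ultimately have "k islimpt ?P" using islimpt_subset islimpt_insert by blast
      moreover have "k \<noteq> l0" using k by (auto simp: s_def)
      ultimately show ?thesis by (simp add: A_def)
    qed
    then show "\<exists>e>0. ball l e \<subseteq> A" using s by blast
  qed
  have cl: "closed {l. l islimpt ?P}" by (rule closed_limpts)
  obtain B where B: "B > 0" "\<And>x. norm (T x) \<le> norm x * B"
    using bounded_linear.pos_bounded[OF complex_operatorD(1)[OF op]] by blast
  have "?P \<subseteq> cball 0 B"
  proof
    fix l assume "l \<in> ?P"
    then obtain x where x: "x \<noteq> 0" "T x = l *\<^sub>C x" by (auto simp: point_spectrum_iff[OF op])
    then show "l \<in> cball 0 B" using B(2)[of x] by (simp add: norm_scaleC)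
  qed
  then have bounded: "l \<in> cball 0 B" if "l islimpt ?P" for l
    using islimpt_subset[OF that] closed_cball[of 0 B] unfolding closed_limpt by blast
  have "connected (- {l0})" by (rule connected_punctured_universe) simp
  moreover have "openin (top_of_set (- {l0})) A"
    using \<open>open A\<close> by (intro open_subset) (auto simp: A_def)
  moreover have "A = - {l0} \<inter> {l. l islimpt ?P}" by (auto simp: A_def)
  then have "closedin (top_of_set (- {l0})) A" by (simp only: closedin_closed_Int[OF cl])
  ultimately have "A = {} \<or> A = - {l0}" unfolding connected_clopen by blast
  moreover have "A \<noteq> - {l0}"
  proof
    assume *: "A = - {l0}"
    have "complex_of_real (B + cmod l0 + 1) \<noteq> l0"
    proof
      assume "complex_of_real (B + cmod l0 + 1) = l0"
      then have "cmod (complex_of_real (B + cmod l0 + 1)) = cmod l0" by (rule arg_cong)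
      then show False using B(1) by (simp only: norm_of_real)
    qed
    then have "complex_of_real (B + cmod l0 + 1) \<in> A" using * by blast
    then have "complex_of_real (B + cmod l0 + 1) islimpt ?P" by (simp only: A_def) blast
    then have "complex_of_real (B + cmod l0 + 1) \<in> cball 0 B" by (rule bounded)
    then have "\<bar>B + cmod l0 + 1\<bar> \<le> B" by (simp only: mem_cball_0 norm_of_real)
    then show False using norm_ge_zero[of l0] by linarith
  qed
  ultimately have "A = {}" by blast
  then have "?P sparse_in (- {l0})"
    unfolding sparse_in_def A_def by (intro ballI exI[of _ "- {l0}"]) auto
  then have "countable (- {l0} \<inter> ?P)" by (intro sparse_imp_countable) auto
  then have "countable (insert l0 (- {l0} \<inter> ?P))" by simp
  then show ?thesis by (rule countable_subset[rotated]) auto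
qed


section \<open>Points of the circle whose factorial powers are close to 1\<close>

definition inv_fact :: "nat \<Rightarrow> real" where
  "inv_fact j = 1 / fact (j + 2)"

lemma inv_fact_pos: "0 < inv_fact j"
  by (simp add: inv_fact_def del: fact_Suc)

lemma inv_fact_Suc: "inv_fact (Suc j) = inv_fact j / real (j + 3)"
  by (simp add: inv_fact_def)

lemma inv_fact_Suc_le: "inv_fact (Suc j) \<le> inv_fact j / 3"
  unfolding inv_fact_Suc using inv_fact_pos[of j] by (intro divide_left_mono) auto

lemma inv_fact_le_half: "inv_fact j \<le> 1 / 2"
proof -
  have "(fact 2 :: real) \<le> fact (j + 2)" by (rule fact_mono) simp
  then show ?thesis by (simp add: inv_fact_def field_simps del: fact_Suc)
qed

text \<open>
  This bounds the tails of the series of \<open>inv_fact\<close> by those of a telescoping series.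
\<close>

lemma inv_fact_le_telescope: "inv_fact j \<le> 2 * inv_fact j - 2 * inv_fact (Suc j)"
  using inv_fact_Suc_le[of j] inv_fact_pos[of j] by simp

lemma inv_fact_tendsto_0: "inv_fact \<longlonglongrightarrow> 0"
proof -
  have "(\<lambda>j. inverse (fact j :: real)) \<longlonglongrightarrow> 0"
    using summable_LIMSEQ_zero[OF summable_exp[of "1::real"]] by simp
  then have "(\<lambda>j. inverse (fact (j + 2) :: real)) \<longlonglongrightarrow> 0" by (rule LIMSEQ_ignore_initial_segment)
  then show ?thesis unfolding inv_fact_def by (simp only: inverse_eq_divide)
qed

lemma inv_fact_telescope_sums:
  "(\<lambda>j. if N \<le> j then 2 * inv_fact j - 2 * inv_fact (Suc j) else 0) sums (2 * inv_fact N)"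
proof -
  define f where "f j = 2 * inv_fact (max N j)" for j
  have "(\<lambda>j. 2 * inv_fact j) \<longlonglongrightarrow> 2 * 0" by (intro tendsto_mult tendsto_const inv_fact_tendsto_0)
  moreover have "eventually (\<lambda>j. 2 * inv_fact j = f j) sequentially"
    by (rule eventually_sequentiallyI[of N]) (simp add: f_def max_def)
  ultimately have "f \<longlonglongrightarrow> 2 * 0" by (rule Lim_transform_eventually)
  from telescope_sums'[OF this] have "(\<lambda>j. f j - f (Suc j)) sums (2 * inv_fact N)"
    by (simp add: f_def)
  moreover have "(\<lambda>j. f j - f (Suc j)) =
      (\<lambda>j. if N \<le> j then 2 * inv_fact j - 2 * inv_fact (Suc j) else 0)"
    by (auto simp: f_def max_def fun_eq_iff not_le less_Suc_eq_le dest: le_antisym)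
  ultimately show ?thesis by simp
qed

text \<open>
  The terms start at \<open>1/2!\<close> so that these sums are distinct modulo \<open>1\<close>.
\<close>

definition fact_sum :: "nat set \<Rightarrow> real" where
  "fact_sum A = (\<Sum>j. if j \<in> A then inv_fact j else 0)"

lemma fact_sum_sums: "(\<lambda>j. if j \<in> A then inv_fact j else 0) sums fact_sum A"
proof -
  have "summable (\<lambda>j. 2 * inv_fact j - 2 * inv_fact (Suc j))"
    using inv_fact_telescope_sums[of 0] by (simp add: sums_iff)
  then have "summable (\<lambda>j. if j \<in> A then inv_fact j else 0)"
  proof (rule summable_comparison_test')
    show "norm (if j \<in> A then inv_fact j else 0) \<le> 2 * inv_fact j - 2 * inv_fact (Suc j)"
      if "0 \<le> j" for j
      using inv_fact_le_telescope[of j] inv_fact_pos[of j] by (cases "j \<in> A") auto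
  qed
  then show ?thesis unfolding fact_sum_def by (rule summable_sums)
qed

lemma fact_sum_nonneg: "0 \<le> fact_sum A"
  by (rule sums_le[OF _ sums_zero fact_sum_sums]) (auto intro: less_imp_le inv_fact_pos)

lemma fact_sum_le:
  assumes "A \<subseteq> {N..}"
  shows "fact_sum A \<le> 2 * inv_fact N"
proof (rule sums_le[OF _ fact_sum_sums inv_fact_telescope_sums])
  show "(if j \<in> A then inv_fact j else 0) \<le>
      (if N \<le> j then 2 * inv_fact j - 2 * inv_fact (Suc j) else 0)" for j
    using inv_fact_le_telescope[of j] inv_fact_pos[of j] assms by (cases "j \<in> A") auto
qed

lemma fact_sum_Un:
  assumes "A \<inter> B = {}"
  shows "fact_sum (A \<union> B) = fact_sum A + fact_sum B"
proof (rule sums_unique2[OF fact_sum_sums])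
  have "(\<lambda>j. (if j \<in> A then inv_fact j else 0) + (if j \<in> B then inv_fact j else 0))
      = (\<lambda>j. if j \<in> A \<union> B then inv_fact j else 0)"
    using assms by (auto simp: fun_eq_iff)
  with sums_add[OF fact_sum_sums[of A] fact_sum_sums[of B]]
  show "(\<lambda>j. if j \<in> A \<union> B then inv_fact j else 0) sums (fact_sum A + fact_sum B)"
    by simp
qed

lemma fact_sum_finite: "finite A \<Longrightarrow> fact_sum A = (\<Sum>j\<in>A. inv_fact j)"
  unfolding fact_sum_def by (subst suminf_finite[of A]) auto

definition circle_point :: "nat set \<Rightarrow> complex" where
  "circle_point A = cis (2 * pi * fact_sum A)"

lemma norm_circle_point [simp]: "cmod (circle_point A) = 1"
  by (simp add: circle_point_def)

lemma circle_point_Un: "A \<inter> B = {} \<Longrightarrow> circle_point (A \<union> B) = circle_point A * circle_point B"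
  by (simp add: circle_point_def fact_sum_Un cis_mult distrib_left)

lemma norm_cis_minus_1_le: "cmod (cis t - 1) \<le> \<bar>t\<bar>"
proof -
  have "cmod (cis t - 1) = 2 * \<bar>sin (t / 2)\<bar>"
    by (simp add: cis_conv_exp dist_exp_i_1)
  also have "\<dots> \<le> 2 * \<bar>t / 2\<bar>" by (intro mult_left_mono abs_sin_x_le_abs_x) auto
  finally show ?thesis by simp
qed

text \<open>
  In \<open>k! * fact_sum A\<close> the terms with \<open>j + 2 \<le> k\<close> are integers, and the remaining ones
  add up to at most \<open>2 / (N + 2)\<close>.
\<close>

lemma circle_point_fact_power_near_1:
  assumes "A \<subseteq> {N..}"
  shows "cmod (circle_point A ^ fact k - 1) \<le> 4 * pi / real (N + 2)"
proof -
  \<comment> \<open>all \<open>j \<in> A\<close> with \<open>j < M\<close> satisfy \<open>j + 2 \<le> k\<close>; if \<open>M = N\<close>, there are none\<close>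
  define M where "M = max N (k - 1)"
  have M: "N \<le> M" "k \<le> M + 1" by (auto simp: M_def)
  have split: "A = (A \<inter> {..<M}) \<union> (A \<inter> {M..})" by auto
  have A: "fact_sum A = fact_sum (A \<inter> {..<M}) + fact_sum (A \<inter> {M..})"
    by (subst split, rule fact_sum_Un) auto
  have int: "fact k * fact_sum (A \<inter> {..<M}) \<in> \<int>"
  proof -
    have "fact k * inv_fact j \<in> \<int>" if j: "j \<in> A \<inter> {..<M}" for j
    proof -
      have "j + 2 \<le> k" using j assms by (auto simp: M_def)
      then obtain q :: nat where "(fact k :: nat) = fact (j + 2) * q"
        using dvdE[OF fact_dvd[of "j + 2" k, where 'a = nat]] by blast
      then have "real (fact k) = real (fact (j + 2) * q)" by (rule arg_cong)
      then have "fact k = fact (j + 2) * real q" by (simp only: of_nat_mult of_nat_fact)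
      then have "fact k * inv_fact j = real q" by (simp add: inv_fact_def del: fact_Suc)
      then show ?thesis by simp
    qed
    then have "(\<Sum>j\<in>A \<inter> {..<M}. fact k * inv_fact j) \<in> \<int>" by (rule Ints_sum)
    then show ?thesis by (simp only: fact_sum_finite finite_Int finite_lessThan simp_thms sum_distrib_left)
  qed
  define r where "r = fact k * fact_sum (A \<inter> {M..})"
  have "r \<le> fact k * (2 * inv_fact M)"
    unfolding r_def by (intro mult_left_mono fact_sum_le) auto
  also have "\<dots> \<le> fact (M + 1) * (2 * inv_fact M)"
    using M(2) inv_fact_pos[of M] by (intro mult_right_mono fact_mono) auto
  also have "\<dots> = 2 / real (M + 2)"
  proof -
    have "fact (M + 2) = real (M + 2) * fact (M + 1)"
      using fact_Suc[of "M + 1", where 'a = real] by simp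
    moreover have "f * (2 * (1 / (q * f))) = 2 / q" if "f \<noteq> 0" for f q :: real
      using that by simp
    ultimately show ?thesis unfolding inv_fact_def by (simp only:) (simp del: fact_Suc)
  qed
  also have "\<dots> \<le> 2 / real (N + 2)" using M(1) by (intro divide_left_mono) auto
  finally have r: "r \<le> 2 / real (N + 2)" .
  have r0: "0 \<le> r" unfolding r_def by (intro mult_nonneg_nonneg fact_sum_nonneg) auto
  have "circle_point A ^ fact k = cis (real (fact k) * (2 * pi * fact_sum A))"
    by (simp only: circle_point_def Complex.DeMoivre)
  also have "real (fact k) * (2 * pi * fact_sum A) =
      2 * pi * (fact k * fact_sum (A \<inter> {..<M})) + 2 * pi * r"
    by (simp add: A r_def algebra_simps)
  also have "cis \<dots> = cis (2 * pi * r)"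
    using cis_multiple_2pi[OF int] by (simp only: cis_mult[symmetric] mult_1_left)
  finally have "cmod (circle_point A ^ fact k - 1) \<le> \<bar>2 * pi * r\<bar>"
    by (simp only: norm_cis_minus_1_le)
  also have "\<dots> = 2 * pi * r" using r0 by simp
  also have "\<dots> \<le> 2 * pi * (2 / real (N + 2))" using r by (intro mult_left_mono) auto
  finally show ?thesis by simp
qed

text \<open>
  If \<open>j\<close> is the least element of the symmetric difference, the two sums differ by
  \<open>1/(j+2)!\<close> up to an error of at most \<open>2/(j+3)!\<close>, so by a number strictly between
  \<open>0\<close> and \<open>1\<close>.
\<close>

lemma inj_circle_point: "inj circle_point"
proof (rule injI, rule ccontr)
  have neq: "circle_point A \<noteq> circle_point B"
    if j: "j \<in> A" "j \<notin> B" and below: "\<And>i. i < j \<Longrightarrow> i \<in> A \<longleftrightarrow> i \<in> B" for A B j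
  proof
    assume eq: "circle_point A = circle_point B"
    let ?C = "A \<inter> {..<j}"
    let ?t = "\<lambda>A. fact_sum (A \<inter> {Suc j..})"
    have "B = ?C \<union> (B \<inter> {Suc j..})"
    proof (rule set_eqI)
      show "i \<in> B \<longleftrightarrow> i \<in> ?C \<union> (B \<inter> {Suc j..})" for i
        using j below[of i] by (cases i j rule: linorder_cases) auto
    qed
    then have B: "fact_sum B = fact_sum ?C + ?t B" by (metis fact_sum_Un IntD1 IntD2 atLeast_iff disjoint_iff lessThan_iff not_less_eq_eq order_less_imp_le)
    have "A = (?C \<union> {j}) \<union> (A \<inter> {Suc j..})" using j(1) by auto
    moreover have "fact_sum ((?C \<union> {j}) \<union> (A \<inter> {Suc j..})) = fact_sum (?C \<union> {j}) + ?t A"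
      by (rule fact_sum_Un) auto
    moreover have "fact_sum (?C \<union> {j}) = fact_sum ?C + fact_sum {j}" by (rule fact_sum_Un) auto
    ultimately have A: "fact_sum A = fact_sum ?C + inv_fact j + ?t A"
      by (simp add: fact_sum_finite del: fact_Suc)
    define x where "x = fact_sum A - fact_sum B"
    have "?t A \<le> 2 * inv_fact (Suc j)" "?t B \<le> 2 * inv_fact (Suc j)"
      by (rule fact_sum_le, blast)+
    moreover have "0 \<le> ?t A" "0 \<le> ?t B" by (rule fact_sum_nonneg)+
    moreover have "x = inv_fact j + ?t A - ?t B" by (simp add: x_def A B)
    ultimately have x: "0 < x" "x < 1"
      using inv_fact_pos[of j] inv_fact_le_half[of j] inv_fact_Suc_le[of j] by linarith+
    have "cis (2 * pi * x) = circle_point A / circle_point B"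
      by (simp add: circle_point_def x_def right_diff_distrib flip: cis_divide)
    also have "\<dots> = 1" using eq norm_circle_point[of B] by (metis divide_self norm_zero zero_neq_one)
    finally have "Re (cis (2 * pi * x)) = Re 1" by (rule arg_cong)
    then have "cos (2 * pi * x) = 1" by simp
    then obtain n :: int where "2 * pi * x = real_of_int n * 2 * pi"
      unfolding cos_one_2pi_int by blast
    then have "x = real_of_int n" by simp
    with x show False by simp
  qed
  fix A B assume eq: "circle_point A = circle_point B" and "A \<noteq> B"
  define D where "D = {i. i \<in> A \<longleftrightarrow> i \<notin> B}"
  define j where "j = (LEAST i. i \<in> D)"
  have "\<exists>i. i \<in> D" using \<open>A \<noteq> B\<close> by (auto simp: D_def)
  then have "j \<in> D" unfolding j_def by (rule LeastI_ex)
  moreover have "i \<in> A \<longleftrightarrow> i \<in> B" if "i < j" for i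
    using not_less_Least[of i "\<lambda>i. i \<in> D"] that by (auto simp: D_def j_def)
  ultimately show False using neq[of j A B] neq[of j B A] eq by (auto simp: D_def)
qed

lemma uncountable_range_circle_point: "uncountable (range circle_point)"
proof
  assume "countable (range circle_point)"
  then have "countable (UNIV :: nat set set)"
    using countable_image_inj_on inj_circle_point by blast
  then obtain f :: "nat \<Rightarrow> nat set" where "range f = UNIV"
    by (metis UNIV_I UNIV_not_empty empty_iff range_from_nat_into)
  then show False using Cantors_theorem[of "UNIV :: nat set"] by auto
qed


section \<open>Lengths of sums of factorials\<close>

text \<open>
  The minimum is taken over a nonempty set, because \<open>1\<close> is a factorial.
\<close>

definition fact_length :: "nat \<Rightarrow> nat" where
  "fact_length m = (LEAST r. \<exists>ks. length ks = r \<and> sum_list (map fact ks) = m)"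

lemma fact_lengthE:
  obtains ks where "length ks = fact_length m" "sum_list (map fact ks) = m"
proof -
  have "sum_list (map fact (replicate m (0::nat))) = m" by (simp add: map_replicate sum_list_replicate)
  then have "\<exists>r ks. length ks = r \<and> sum_list (map fact ks) = m" by blast
  from LeastI_ex[OF this]
  have "\<exists>ks. length ks = fact_length m \<and> sum_list (map fact ks) = m"
    by (simp only: fact_length_def)
  then show ?thesis using that by (elim exE conjE)
qed

lemma fact_length_add_fact: "fact_length (m + fact k) \<le> Suc (fact_length m)"
proof -
  obtain ks where "length ks = fact_length m" "sum_list (map fact ks) = m" by (rule fact_lengthE)
  then have "\<exists>ks'. length ks' = Suc (fact_length m) \<and> sum_list (map fact ks') = m + fact k"
    by (intro exI[of _ "k # ks"]) simp
  then show ?thesis unfolding fact_length_def[of "m + fact k"] by (rule Least_le)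
qed

lemma norm_power_diff_le_fact_length:
  fixes a b :: complex
  assumes "cmod a = 1" "cmod b = 1" and d: "\<And>k. cmod (a ^ fact k - b ^ fact k) \<le> d"
  shows "cmod (a ^ m - b ^ m) \<le> real (fact_length m) * d"
proof -
  have "cmod (a ^ sum_list (map fact ks) - b ^ sum_list (map fact ks)) \<le> real (length ks) * d" for ks
  proof (induction ks)
    case (Cons k ks)
    let ?s = "sum_list (map fact ks)"
    have "a ^ sum_list (map fact (k # ks)) - b ^ sum_list (map fact (k # ks)) =
        (a ^ fact k - b ^ fact k) * a ^ ?s + b ^ fact k * (a ^ ?s - b ^ ?s)"
    proof -
      have "x * y - z * w = (x - z) * y + z * (y - w)" for x y z w :: complex
        by (simp add: algebra_simps)
      then show ?thesis by (simp only: list.map sum_list.Cons power_add)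
    qed
    also have "cmod \<dots> \<le> cmod (a ^ fact k - b ^ fact k) + cmod (a ^ ?s - b ^ ?s)"
      using assms(1,2) norm_triangle_ineq[of "(a ^ fact k - b ^ fact k) * a ^ ?s" "b ^ fact k * (a ^ ?s - b ^ ?s)"]
      by (simp add: norm_mult norm_power)
    also have "\<dots> \<le> d + real (length ks) * d" by (intro add_mono d Cons)
    finally show ?case by (simp add: algebra_simps)
  qed simp
  then show ?thesis using fact_lengthE[of m] by metis
qed

text \<open>
  Adding a factorial costs at most a factor \<open>2\<close>, which bounds the corresponding powers of the shift.
  At the same time the weight absorbs the factor \<open>fact_length m\<close> of the preceding lemma.
\<close>

definition weight :: "nat \<Rightarrow> real" where
  "weight m = (1 / 2) ^ fact_length m"

lemma weight: "0 < weight m" "weight m \<le> 1" "weight m \<le> 2 * weight (m + fact k)"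
proof -
  have "(1 / 2 :: real) ^ Suc (fact_length m) \<le> (1 / 2) ^ fact_length (m + fact k)"
    by (rule power_decreasing[OF fact_length_add_fact]) auto
  then show "weight m \<le> 2 * weight (m + fact k)" by (simp add: weight_def)
qed (auto simp: weight_def power_le_one)

lemma weight_fact_length_le: "weight m * real (fact_length m) \<le> 1"
proof -
  have "real (fact_length m) \<le> 2 ^ fact_length m" by (simp add: of_nat_less_two_power less_imp_le)
  then show ?thesis by (simp add: weight_def power_divide field_simps)
qed


section \<open>The weighted shift\<close>

text \<open>
  The metric inherited from the reals induces the discrete topology, so that the bounded continuous
  functions on the natural numbers are the bounded sequences and form a Banach space.
\<close>

instantiation nat :: metric_space
begin

definition dist_nat :: "nat \<Rightarrow> nat \<Rightarrow> real" where
  "dist_nat m n = \<bar>real m - real n\<bar>"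

definition uniformity_nat :: "(nat \<times> nat) filter" where
  "uniformity_nat = (INF e\<in>{0<..}. principal {(x, y). dist x y < e})"

instance
proof
  show "uniformity = (INF e\<in>{0<..}. principal {(x :: nat, y). dist x y < e})"
    by (rule uniformity_nat_def)
  show "dist x y = 0 \<longleftrightarrow> x = y" for x y :: nat
    by (simp add: dist_nat_def)
  show "dist x y \<le> dist x z + dist y z" for x y z :: nat
    by (simp add: dist_nat_def)
  have "eventually (\<lambda>(x' :: nat, y). x' = x \<longrightarrow> y \<in> U) uniformity" if "x \<in> U" for x U
    unfolding uniformity_nat_def
  proof (rule eventually_INF1[of "1 / 2"])
    have "\<bar>real x - real y\<bar> < 1 / 2 \<Longrightarrow> y = x" for y by linarith
    with that show "eventually (\<lambda>(x', y). x' = x \<longrightarrow> y \<in> U) (principal {(x :: nat, y). dist x y < 1 / 2})"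
      by (auto simp: eventually_principal dist_nat_def)
  qed simp
  then show "open U \<longleftrightarrow> (\<forall>x\<in>U. eventually (\<lambda>(x', y). x' = x \<longrightarrow> y \<in> U) uniformity)"
    for U :: "nat set"
    by (simp add: open_discrete)
qed

end

instantiation complex :: complex_normed_vector
begin

definition scaleC_complex :: "complex \<Rightarrow> complex \<Rightarrow> complex" where
  "scaleC_complex = (*)"

instance
  by standard (simp_all add: scaleC_complex_def algebra_simps norm_mult scaleR_conv_of_real)

end

instance complex :: complex_banach ..

instantiation bcontfun :: (topological_space, complex_normed_vector) complex_normed_vector
begin

definition scaleC_bcontfun :: "complex \<Rightarrow> ('a \<Rightarrow>\<^sub>C 'b) \<Rightarrow> 'a \<Rightarrow>\<^sub>C 'b" where
  "scaleC_bcontfun c f = Bcontfun (\<lambda>x. c *\<^sub>C apply_bcontfun f x)"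

lemma apply_bcontfun_scaleC [simp]:
  "apply_bcontfun (c *\<^sub>C f) x = c *\<^sub>C apply_bcontfun f x" for f :: "'a \<Rightarrow>\<^sub>C 'b"
proof -
  have "continuous_on UNIV (\<lambda>x. c *\<^sub>C apply_bcontfun f x)"
    by (rule bounded_linear.continuous_on[OF bounded_linear_scaleC continuous_on_apply_bcontfun])
  moreover have "norm (c *\<^sub>C apply_bcontfun f x) \<le> cmod c * norm f" for x
    by (simp add: norm_scaleC mult_left_mono norm_bounded)
  ultimately have "(\<lambda>x. c *\<^sub>C apply_bcontfun f x) \<in> bcontfun" by (rule bcontfun_normI)
  then show ?thesis by (simp add: scaleC_bcontfun_def Bcontfun_inverse)
qed

instance
proof
  fix a b :: complex and r :: real and f g :: "'a \<Rightarrow>\<^sub>C 'b"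
  show "a *\<^sub>C (f + g) = a *\<^sub>C f + a *\<^sub>C g" "(a + b) *\<^sub>C f = a *\<^sub>C f + b *\<^sub>C f"
    "a *\<^sub>C b *\<^sub>C f = (a * b) *\<^sub>C f" "1 *\<^sub>C f = f" "r *\<^sub>R f = complex_of_real r *\<^sub>C f"
    by (rule bcontfun_eqI; simp add: scaleC_add_left scaleC_add_right scaleC_scaleC scaleC_one
        scaleR_scaleC)+
  have le: "norm (c *\<^sub>C h) \<le> cmod c * norm h" for c and h :: "'a \<Rightarrow>\<^sub>C 'b"
    by (rule norm_bound) (simp add: norm_scaleC mult_left_mono norm_bounded)
  show "norm (a *\<^sub>C f) = cmod a * norm f"
  proof (cases "a = 0")
    case True
    then show ?thesis using le[of a f] by simp
  next
    case False
    have "inverse a *\<^sub>C a *\<^sub>C f = f"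
      by (rule bcontfun_eqI) (simp add: False scaleC_scaleC scaleC_one)
    then have "norm f \<le> inverse (cmod a) * norm (a *\<^sub>C f)"
      using le[of "inverse a" "a *\<^sub>C f"] by (simp add: norm_inverse)
    then have "cmod a * norm f \<le> norm (a *\<^sub>C f)" using False by (simp add: field_simps)
    with le[of a f] show ?thesis by (rule antisym)
  qed
qed

end

instance bcontfun :: (metric_space, complex_banach) complex_banach ..

lemma bcontfun_natI: "(\<And>m. norm (f m) \<le> b) \<Longrightarrow> f \<in> bcontfun" for f :: "nat \<Rightarrow> complex"
  by (rule bcontfun_normI) (simp_all add: continuous_on_discrete)

text \<open>
  A sequence \<open>x\<close> of the weighted space is represented by the bounded sequence
  \<open>weight m * x m\<close>; on these representatives, the left shift becomes the operator
  \<open>weighted_shift\<close> below, and the eigenvector \<open>a ^ m\<close> becomes \<open>weighted_powers a\<close>.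
\<close>

definition weighted_powers :: "complex \<Rightarrow> nat \<Rightarrow>\<^sub>C complex" where
  "weighted_powers a = Bcontfun (\<lambda>m. complex_of_real (weight m) * a ^ m)"

lemma apply_weighted_powers:
  assumes "cmod a = 1"
  shows "apply_bcontfun (weighted_powers a) m = complex_of_real (weight m) * a ^ m"
proof -
  have "(\<lambda>m. complex_of_real (weight m) * a ^ m) \<in> bcontfun"
    by (rule bcontfun_natI[of _ 1])
      (use assms weight(1,2) in \<open>simp add: norm_mult norm_power less_imp_le\<close>)
  then show ?thesis by (simp add: weighted_powers_def Bcontfun_inverse)
qed

lemma norm_weighted_powers_diff_le:
  assumes "cmod a = 1" "cmod b = 1" and d: "\<And>k. cmod (a ^ fact k - b ^ fact k) \<le> d"
  shows "norm (weighted_powers a - weighted_powers b) \<le> d"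
proof (rule norm_bound)
  fix m
  have "0 \<le> d" using d[of 0] norm_ge_zero order_trans by blast
  have "norm (apply_bcontfun (weighted_powers a - weighted_powers b) m) = weight m * cmod (a ^ m - b ^ m)"
    using weight(1)[of m]
    by (simp add: apply_weighted_powers assms(1,2) norm_mult flip: right_diff_distrib)
  also have "\<dots> \<le> weight m * (real (fact_length m) * d)"
    using weight(1)[of m] norm_power_diff_le_fact_length[OF assms] by (intro mult_left_mono) auto
  also have "\<dots> = (weight m * real (fact_length m)) * d" by simp
  also have "\<dots> \<le> 1 * d" using weight_fact_length_le \<open>0 \<le> d\<close> by (intro mult_right_mono)
  finally show "norm (apply_bcontfun (weighted_powers a - weighted_powers b) m) \<le> d" by simp
qed

text \<open>
  The quotients of consecutive weights are at most \<open>2\<close>, since \<open>1\<close> is a factorial.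
\<close>

definition weighted_shift :: "(nat \<Rightarrow>\<^sub>C complex) \<Rightarrow> nat \<Rightarrow>\<^sub>C complex" where
  "weighted_shift f = Bcontfun (\<lambda>m. complex_of_real (weight m / weight (Suc m)) * apply_bcontfun f (Suc m))"

lemma apply_weighted_shift [simp]:
  "apply_bcontfun (weighted_shift f) m = complex_of_real (weight m / weight (Suc m)) * apply_bcontfun f (Suc m)"
proof -
  have "(\<lambda>m. complex_of_real (weight m / weight (Suc m)) * apply_bcontfun f (Suc m)) \<in> bcontfun"
  proof (rule bcontfun_natI[of _ "2 * norm f"])
    fix m
    have "weight m / weight (Suc m) \<le> 2" "0 \<le> weight m / weight (Suc m)"
      using weight(1)[of m] weight(1)[of "Suc m"] weight(3)[of m 0] by (auto simp: field_simps)
    then have "(weight m / weight (Suc m)) * norm (apply_bcontfun f (Suc m)) \<le> 2 * norm f"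
      by (intro mult_mono norm_bounded) auto
    then show "norm (complex_of_real (weight m / weight (Suc m)) * apply_bcontfun f (Suc m)) \<le> 2 * norm f"
      using weight(1)[of m] weight(1)[of "Suc m"] by (simp add: norm_mult norm_divide)
  qed
  then show ?thesis by (simp add: weighted_shift_def Bcontfun_inverse)
qed

lemma apply_weighted_shift_funpow:
  "apply_bcontfun ((weighted_shift ^^ n) f) m = complex_of_real (weight m / weight (m + n)) * apply_bcontfun f (m + n)"
proof (induction n arbitrary: m)
  case 0
  then show ?case using weight(1)[of m] by simp
next
  case (Suc n)
  then show ?case using weight(1)[of "Suc m"] by simp
qed

lemma norm_weighted_shift_fact_power_le: "norm ((weighted_shift ^^ fact k) f) \<le> 2 * norm f"
proof (rule norm_bound)
  fix m
  have "weight m / weight (m + fact k) \<le> 2" "0 \<le> weight m / weight (m + fact k)"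
    using weight(1)[of m] weight(1)[of "m + fact k"] weight(3)[of m k] by (auto simp: field_simps)
  then have "(weight m / weight (m + fact k)) * norm (apply_bcontfun f (m + fact k)) \<le> 2 * norm f"
    by (intro mult_mono norm_bounded) auto
  then show "norm (apply_bcontfun ((weighted_shift ^^ fact k) f) m) \<le> 2 * norm f"
    using weight(1)[of m] weight(1)[of "m + fact k"]
    by (simp add: apply_weighted_shift_funpow norm_mult norm_divide)
qed

lemma complex_operator_weighted_shift: "complex_operator weighted_shift"
  unfolding complex_operator_def
proof (intro conjI allI)
  show "weighted_shift (c *\<^sub>C f) = c *\<^sub>C weighted_shift f" for c f
    by (rule bcontfun_eqI) (simp add: scaleC_complex_def)
  show "bounded_linear weighted_shift"
  proof (rule bounded_linear_intro)
    show "weighted_shift (f + g) = weighted_shift f + weighted_shift g" for f g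
      by (rule bcontfun_eqI) (simp add: distrib_left)
    show "weighted_shift (r *\<^sub>R f) = r *\<^sub>R weighted_shift f" for r f
      by (rule bcontfun_eqI) (simp add: scaleR_conv_of_real)
    show "norm (weighted_shift f) \<le> norm f * 2" for f
      using norm_weighted_shift_fact_power_le[of 0 f] by (simp add: mult.commute)
  qed
qed

lemma weighted_shift_weighted_powers:
  assumes "cmod a = 1"
  shows "weighted_shift (weighted_powers a) = a *\<^sub>C weighted_powers a"
proof (rule bcontfun_eqI)
  show "apply_bcontfun (weighted_shift (weighted_powers a)) m =
      apply_bcontfun (a *\<^sub>C weighted_powers a) m" for m
    using weight(1)[of "Suc m"] by (simp add: apply_weighted_powers[OF assms] scaleC_complex_def)
qed

abbreviation eigenvectors :: "(nat \<Rightarrow>\<^sub>C complex) set" where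
  "eigenvectors \<equiv> range (\<lambda>A. weighted_powers (circle_point A))"

lemma weighted_shift_closed_span:
  assumes "f \<in> closure (complex_vector.span eigenvectors)"
  shows "weighted_shift f \<in> closure (complex_vector.span eigenvectors)"
proof -
  interpret S: module_hom scaleC scaleC weighted_shift
    by unfold_locales (simp_all add: complex_operatorD(2,3)[OF complex_operator_weighted_shift])
  have "weighted_shift ` complex_vector.span eigenvectors = complex_vector.span (weighted_shift ` eigenvectors)"
    by (rule S.span_image[symmetric])
  also have "\<dots> \<subseteq> complex_vector.span eigenvectors"
  proof (rule complex_vector.span_minimal[OF _ complex_vector.subspace_span])
    show "weighted_shift ` eigenvectors \<subseteq> complex_vector.span eigenvectors"
    proof (rule image_subsetI)
      fix f assume "f \<in> eigenvectors"
      then obtain A where A: "f = weighted_powers (circle_point A)" by blast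
      have "circle_point A *\<^sub>C f \<in> complex_vector.span eigenvectors"
        unfolding A by (intro complex_vector.span_scale complex_vector.span_base rangeI)
      then show "weighted_shift f \<in> complex_vector.span eigenvectors"
        by (simp only: A weighted_shift_weighted_powers norm_circle_point)
    qed
  qed
  finally have "weighted_shift ` complex_vector.span eigenvectors \<subseteq> closure (complex_vector.span eigenvectors)"
    using closure_subset by (rule subset_trans)
  then have "weighted_shift ` closure (complex_vector.span eigenvectors) \<subseteq> closure (complex_vector.span eigenvectors)"
    by (intro image_closure_subset linear_continuous_on complex_operatorD(1)[OF complex_operator_weighted_shift])
      simp_all
  with assms show ?thesis by blast
qed


section \<open>A sequence that is not a Jamison sequence\<close>

lemma complex_rational_approx:
  fixes a :: complex
  assumes "e > 0"
  obtains p q :: rat where "cmod (Complex (of_rat p) (of_rat q) - a) < e"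
proof -
  obtain p where p: "Re a - e / 2 < of_rat p" "of_rat p < Re a + e / 2"
    using of_rat_dense[of "Re a - e / 2" "Re a + e / 2"] assms by auto
  obtain q where q: "Im a - e / 2 < of_rat q" "of_rat q < Im a + e / 2"
    using of_rat_dense[of "Im a - e / 2" "Im a + e / 2"] assms by auto
  have "cmod (Complex (of_rat p) (of_rat q) - a) \<le> \<bar>of_rat p - Re a\<bar> + \<bar>of_rat q - Im a\<bar>"
    using cmod_le[of "Complex (of_rat p) (of_rat q) - a"] by simp
  also have "\<dots> < e" using p q by linarith
  finally show ?thesis by (rule that)
qed

lemma countable_dense_subset_span:
  fixes C :: "'a::complex_normed_vector set"
  assumes "countable C"
  obtains D where "countable D" "D \<subseteq> complex_vector.span C" "complex_vector.span C \<subseteq> closure D"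
proof -
  define comb where "comb = (\<lambda>xs. sum_list (map (\<lambda>((p, q), x :: 'a). Complex (of_rat p) (of_rat q) *\<^sub>C x) xs))"
  define D where "D = comb ` lists (UNIV \<times> C)"
  have "countable D"
    unfolding D_def by (intro countable_image countable_lists countable_SIGMA assms) auto
  moreover have "D \<subseteq> complex_vector.span C"
  proof -
    have "comb xs \<in> complex_vector.span C" if "xs \<in> lists (UNIV \<times> C)" for xs
      using that
    proof (induction xs)
      case Nil
      show ?case by (simp add: comb_def complex_vector.span_zero)
    next
      case (Cons v xs)
      obtain p q x where v: "v = ((p, q), x)" by (metis prod.exhaust)
      have "x \<in> C" using Cons.hyps v by simp
      then have "Complex (of_rat p) (of_rat q) *\<^sub>C x \<in> complex_vector.span C"
        by (intro complex_vector.span_scale complex_vector.span_base)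
      from complex_vector.span_add[OF this Cons.IH] show ?case by (simp add: comb_def v)
    qed
    then show ?thesis by (auto simp: D_def)
  qed
  moreover have "complex_vector.span C \<subseteq> closure D"
  proof
    fix y assume "y \<in> complex_vector.span C"
    then show "y \<in> closure D"
    proof (induction rule: complex_vector.span_induct_alt)
      case base
      have "comb [] \<in> D" unfolding D_def by (rule imageI) simp
      then show ?case using closure_subset[of D] by (auto simp: comb_def)
    next
      case (step c x y)
      show ?case
        unfolding closure_approachable
      proof (intro allI impI)
        fix e :: real assume "e > 0"
        obtain z where z: "z \<in> D" "dist z y < e / 2"
          using step(2) \<open>e > 0\<close> unfolding closure_approachable by (meson half_gt_zero)
        then obtain xs where xs: "xs \<in> lists (UNIV \<times> C)" "z = comb xs" by (auto simp: D_def)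
        have "e / 2 / (norm x + 1) > 0" using \<open>e > 0\<close> by (simp add: add_nonneg_pos)
        then obtain p q where pq: "cmod (Complex (of_rat p) (of_rat q) - c) < e / 2 / (norm x + 1)"
          by (rule complex_rational_approx)
        let ?w = "Complex (of_rat p) (of_rat q) *\<^sub>C x"
        have "?w + z = comb (((p, q), x) # xs)" by (simp add: comb_def xs(2))
        moreover have "((p, q), x) # xs \<in> lists (UNIV \<times> C)" using xs(1) step(1) by simp
        ultimately have "?w + z \<in> D" unfolding D_def by (rule image_eqI)
        moreover have "dist (?w + z) (c *\<^sub>C x + y) < e"
        proof -
          have "(?w + z) - (c *\<^sub>C x + y) = (Complex (of_rat p) (of_rat q) - c) *\<^sub>C x + (z - y)"
            by (simp add: complex_vector.scale_left_diff_distrib)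
          then have "dist (?w + z) (c *\<^sub>C x + y) \<le>
              cmod (Complex (of_rat p) (of_rat q) - c) * norm x + dist z y"
            unfolding dist_norm
            using norm_triangle_ineq[of "(Complex (of_rat p) (of_rat q) - c) *\<^sub>C x" "z - y"]
            by (simp only: norm_scaleC)
          moreover have "cmod (Complex (of_rat p) (of_rat q) - c) * norm x \<le>
              e / 2 / (norm x + 1) * (norm x + 1)"
            using pq \<open>e > 0\<close> by (intro mult_mono) auto
          moreover have "e / 2 / (norm x + 1) * (norm x + 1) = e / 2"
          proof -
            have "norm x + 1 \<noteq> 0" using norm_ge_zero[of x] by linarith
            moreover have "u / v * v = u" if "v \<noteq> 0" for u v :: real using that by simp
            ultimately show ?thesis by blast
          qed
          ultimately show ?thesis using z(2) by linarith
        qed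
        ultimately show "\<exists>v\<in>D. dist v (c *\<^sub>C x + y) < e" by blast
      qed
    qed
  qed
  ultimately show ?thesis by (rule that)
qed

text \<open>
  Removing the elements \<open>\<ge> N\<close> from \<open>A\<close> divides \<open>circle_point A\<close> by a point all of whose factorial
  powers are close to \<open>1\<close>.
\<close>

lemma weighted_powers_circle_point_approx:
  assumes "e > 0"
  obtains B where "finite B"
    "norm (weighted_powers (circle_point A) - weighted_powers (circle_point B)) < e"
proof -
  obtain N where "4 * pi / e < real N" using reals_Archimedean2 by blast
  then have N: "4 * pi / real (N + 2) < e"
    using assms by (simp add: field_simps add_pos_pos)
  define B where "B = A \<inter> {..<N}"
  define B' where "B' = A \<inter> {N..}"
  have "A = B \<union> B'" "B \<inter> B' = {}" by (auto simp: B_def B'_def)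
  then have A: "circle_point A = circle_point B * circle_point B'"
    using circle_point_Un[of B B'] by simp
  have "norm (weighted_powers (circle_point A) - weighted_powers (circle_point B)) \<le> 4 * pi / real (N + 2)"
  proof (rule norm_weighted_powers_diff_le)
    fix k
    have "circle_point A ^ fact k - circle_point B ^ fact k =
        circle_point B ^ fact k * (circle_point B' ^ fact k - 1)"
      by (simp only: A power_mult_distrib right_diff_distrib mult_1_right)
    also have "cmod \<dots> = cmod (circle_point B' ^ fact k - 1)"
      by (simp add: norm_mult norm_power)
    also have "\<dots> \<le> 4 * pi / real (N + 2)"
      by (rule circle_point_fact_power_near_1) (simp add: B'_def)
    finally show "cmod (circle_point A ^ fact k - circle_point B ^ fact k) \<le> 4 * pi / real (N + 2)" .
  qed simp_all
  then show ?thesis using that[of B] N by (simp add: B_def)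
qed

lemma separable_closed_span_eigenvectors:
  obtains D where "countable D" "D \<subseteq> complex_vector.span eigenvectors"
    "closure (complex_vector.span eigenvectors) \<subseteq> closure D"
proof -
  define C where "C = (\<lambda>A. weighted_powers (circle_point A)) ` Collect finite"
  have "countable C" unfolding C_def by (intro countable_image countable_Collect_finite)
  then obtain D where D: "countable D" "D \<subseteq> complex_vector.span C" "complex_vector.span C \<subseteq> closure D"
    by (rule countable_dense_subset_span)
  have "eigenvectors \<subseteq> closure C"
  proof (rule image_subsetI)
    fix A
    show "weighted_powers (circle_point A) \<in> closure C"
      unfolding closure_approachable
    proof (intro allI impI)
      fix e :: real assume "e > 0"
      then obtain B where "finite B"
        "norm (weighted_powers (circle_point A) - weighted_powers (circle_point B)) < e"
        by (rule weighted_powers_circle_point_approx)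
      then show "\<exists>y\<in>C. dist y (weighted_powers (circle_point A)) < e"
        unfolding C_def by (intro bexI[of _ "weighted_powers (circle_point B)"])
          (auto simp: dist_norm norm_minus_commute)
    qed
  qed
  also have "closure C \<subseteq> closure (complex_vector.span C)"
    by (rule closure_mono) (rule complex_vector.span_superset)
  finally have "complex_vector.span eigenvectors \<subseteq> closure (complex_vector.span C)"
    using closed_csubspace_closure[OF complex_vector.subspace_span, of C]
    by (intro complex_vector.span_minimal) (simp_all add: closed_csubspace_def)
  also have "\<dots> \<subseteq> closure D"
    using D(3) by (rule closure_minimal) simp
  finally have "closure (complex_vector.span eigenvectors) \<subseteq> closure D"
    by (rule closure_minimal) simp
  moreover have "D \<subseteq> complex_vector.span eigenvectors"
    using D(2) by (rule order_trans) (rule complex_vector.span_mono, auto simp: C_def)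
  ultimately show ?thesis using D(1) that by blast
qed

text \<open>
  The space of all bounded sequences is not separable; the closed span of the eigenvectors is, and it
  is invariant under the shift.
\<close>

typedef shift_space = "closure (complex_vector.span eigenvectors)"
proof -
  have "0 \<in> complex_vector.span eigenvectors" by (rule complex_vector.span_zero)
  then show ?thesis using closure_subset by blast
qed

lemma closed_csubspace_shift_space: "closed_csubspace (closure (complex_vector.span eigenvectors))"
  by (rule closed_csubspace_closure[OF complex_vector.subspace_span])

setup_lifting type_definition_shift_space

instantiation shift_space :: complex_normed_vector
begin

lift_definition zero_shift_space :: shift_space is 0
  by (rule closed_csubspaceD(2)[OF closed_csubspace_shift_space])

lift_definition plus_shift_space :: "shift_space \<Rightarrow> shift_space \<Rightarrow> shift_space" is "(+)"
  by (rule closed_csubspaceD(3)[OF closed_csubspace_shift_space])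

lift_definition minus_shift_space :: "shift_space \<Rightarrow> shift_space \<Rightarrow> shift_space" is "(-)"
  by (rule closed_csubspaceD(4)[OF closed_csubspace_shift_space])

lift_definition scaleC_shift_space :: "complex \<Rightarrow> shift_space \<Rightarrow> shift_space" is scaleC
  by (rule closed_csubspaceD(5)[OF closed_csubspace_shift_space])

lift_definition norm_shift_space :: "shift_space \<Rightarrow> real" is norm .

definition uminus_shift_space :: "shift_space \<Rightarrow> shift_space" where
  "uminus_shift_space x = 0 - x"

definition scaleR_shift_space :: "real \<Rightarrow> shift_space \<Rightarrow> shift_space" where
  "scaleR_shift_space r x = complex_of_real r *\<^sub>C x"

definition dist_shift_space :: "shift_space \<Rightarrow> shift_space \<Rightarrow> real" where
  "dist_shift_space x y = norm (x - y)"

definition sgn_shift_space :: "shift_space \<Rightarrow> shift_space" where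
  "sgn_shift_space x = inverse (norm x) *\<^sub>R x"

definition uniformity_shift_space :: "(shift_space \<times> shift_space) filter" where
  "uniformity_shift_space = (INF e\<in>{0<..}. principal {(x, y). dist x y < e})"

definition open_shift_space :: "shift_space set \<Rightarrow> bool" where
  "open_shift_space U \<longleftrightarrow> (\<forall>x\<in>U. eventually (\<lambda>(x', y). x' = x \<longrightarrow> y \<in> U) uniformity)"

instance
proof
  fix a b :: complex and r s :: real and x y z :: shift_space
  show "x + y + z = x + (y + z)" "x + y = y + x" "0 + x = x"
    by (transfer; simp add: add_ac)+
  show "- x + x = 0" "x - y = x + - y"
    unfolding uminus_shift_space_def by (transfer; simp)+
  have C: "a *\<^sub>C (x + y) = a *\<^sub>C x + a *\<^sub>C y" "(a + b) *\<^sub>C x = a *\<^sub>C x + b *\<^sub>C x"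
    "a *\<^sub>C b *\<^sub>C x = (a * b) *\<^sub>C x" "1 *\<^sub>C x = x" "norm (a *\<^sub>C x) = cmod a * norm x"
    for a b and x y :: shift_space
    by (transfer; simp add: scaleC_add_left scaleC_add_right scaleC_scaleC scaleC_one norm_scaleC)+
  show "a *\<^sub>C (x + y) = a *\<^sub>C x + a *\<^sub>C y" "(a + b) *\<^sub>C x = a *\<^sub>C x + b *\<^sub>C x"
    "a *\<^sub>C b *\<^sub>C x = (a * b) *\<^sub>C x" "1 *\<^sub>C x = x" "norm (a *\<^sub>C x) = cmod a * norm x"
    by (rule C)+
  show "r *\<^sub>R x = complex_of_real r *\<^sub>C x" by (rule scaleR_shift_space_def)
  show "r *\<^sub>R (x + y) = r *\<^sub>R x + r *\<^sub>R y" "(r + s) *\<^sub>R x = r *\<^sub>R x + s *\<^sub>R x"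
    "r *\<^sub>R s *\<^sub>R x = (r * s) *\<^sub>R x" "1 *\<^sub>R x = x" "norm (r *\<^sub>R x) = \<bar>r\<bar> * norm x"
    by (simp_all add: scaleR_shift_space_def C)
  show "norm x = 0 \<longleftrightarrow> x = 0" "norm (x + y) \<le> norm x + norm y"
    by (transfer; simp add: norm_triangle_ineq)+
  show "dist x y = norm (x - y)" "sgn x = inverse (norm x) *\<^sub>R x"
    "uniformity = (INF e\<in>{0<..}. principal {(x :: shift_space, y). dist x y < e})"
    by (rule dist_shift_space_def sgn_shift_space_def uniformity_shift_space_def)+
  show "open U \<longleftrightarrow> (\<forall>x\<in>U. eventually (\<lambda>(x', y). x' = x \<longrightarrow> y \<in> U) uniformity)" for U :: "shift_space set"
    by (rule open_shift_space_def)
qed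

end

lemma dist_Rep_shift_space: "dist (Rep_shift_space x) (Rep_shift_space y) = dist x y"
  unfolding dist_norm by transfer (rule refl)

instance shift_space :: complex_banach
proof
  fix X :: "nat \<Rightarrow> shift_space"
  assume "Cauchy X"
  then have "Cauchy (\<lambda>n. Rep_shift_space (X n))"
    by (simp add: Cauchy_def dist_Rep_shift_space)
  then obtain f where f: "(\<lambda>n. Rep_shift_space (X n)) \<longlonglongrightarrow> f"
    using Cauchy_convergent convergent_def by blast
  have "f \<in> closure (complex_vector.span eigenvectors)"
    by (rule closed_sequentially[OF closed_closure _ f]) (rule Rep_shift_space)
  then obtain x where "f = Rep_shift_space x" by (rule Rep_shift_space_cases)
  with f have "X \<longlonglongrightarrow> x" by (simp add: tendsto_iff dist_Rep_shift_space)
  then show "convergent X" by (rule convergentI)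
qed

lemma separable_shift_space: "separable_space (euclidean :: shift_space topology)"
proof -
  obtain D where D: "countable D" "D \<subseteq> complex_vector.span eigenvectors"
    "closure (complex_vector.span eigenvectors) \<subseteq> closure D"
    by (rule separable_closed_span_eigenvectors)
  have D': "D \<subseteq> closure (complex_vector.span eigenvectors)"
    using D(2) closure_subset by (rule subset_trans)
  have "x \<in> closure (Abs_shift_space ` D)" for x
    unfolding closure_approachable
  proof (intro allI impI)
    fix e :: real assume "e > 0"
    have "Rep_shift_space x \<in> closure D" using Rep_shift_space D(3) by (rule subsetD[rotated])
    then obtain y where y: "y \<in> D" "dist y (Rep_shift_space x) < e"
      using \<open>e > 0\<close> unfolding closure_approachable by meson
    have "y = Rep_shift_space (Abs_shift_space y)"
      using y(1) D' by (intro Abs_shift_space_inverse[symmetric]) auto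
    then have "dist (Abs_shift_space y) x < e" using y(2) dist_Rep_shift_space by metis
    then show "\<exists>y\<in>Abs_shift_space ` D. dist y x < e" using y(1) by blast
  qed
  then show ?thesis
    unfolding separable_space_def using D(1)
    by (intro exI[of _ "Abs_shift_space ` D"]) auto
qed

lift_definition shift :: "shift_space \<Rightarrow> shift_space" is weighted_shift
  by (rule weighted_shift_closed_span)

lemma Rep_shift_funpow: "Rep_shift_space ((shift ^^ n) x) = (weighted_shift ^^ n) (Rep_shift_space x)"
  by (induction n) (simp_all add: shift.rep_eq)

lemma complex_operator_shift: "complex_operator shift"
  unfolding complex_operator_def
proof (intro conjI allI)
  show "shift (c *\<^sub>C x) = c *\<^sub>C shift x" for c x
    by transfer (rule complex_operatorD(2)[OF complex_operator_weighted_shift])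
  then have R: "shift (r *\<^sub>R x) = r *\<^sub>R shift x" for r x by (simp add: scaleR_scaleC)
  show "bounded_linear shift"
  proof (rule bounded_linear_intro[OF _ R])
    show "shift (x + y) = shift x + shift y" for x y
      by transfer (rule complex_operatorD(3)[OF complex_operator_weighted_shift])
    show "norm (shift x) \<le> norm x * 2" for x
      by transfer (use norm_weighted_shift_fact_power_le[of 0] in \<open>simp add: mult.commute\<close>)
  qed
qed

lemma partially_power_bounded_shift: "partially_power_bounded shift (\<lambda>k. fact (Suc k))"
proof -
  have "norm ((shift ^^ fact k) x) \<le> 2 * norm x" for k x
    by (simp only: norm_shift_space.rep_eq Rep_shift_funpow norm_weighted_shift_fact_power_le)
  then have "onorm (shift ^^ fact k) \<le> 2" for k by (intro onorm_bound) auto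
  then show ?thesis by (auto simp: partially_power_bounded_def simp del: fact_Suc intro!: bdd_aboveI[of _ 2])
qed

lemma circle_point_in_point_spectrum: "circle_point A \<in> point_spectrum shift"
proof -
  let ?f = "weighted_powers (circle_point A)"
  have "?f \<in> complex_vector.span eigenvectors" by (rule complex_vector.span_base) simp
  then have "?f \<in> closure (complex_vector.span eigenvectors)" by (rule subsetD[OF closure_subset])
  then obtain x where x: "?f = Rep_shift_space x" by (rule Rep_shift_space_cases)
  have "apply_bcontfun ?f 0 \<noteq> 0" using weight(1)[of 0] by (simp add: apply_weighted_powers)
  then have "Rep_shift_space x \<noteq> 0" unfolding x[symmetric] by auto
  then have "x \<noteq> 0" by transfer
  moreover have "shift x = circle_point A *\<^sub>C x"
    unfolding Rep_shift_space_inject[symmetric] shift.rep_eq scaleC_shift_space.rep_eq x[symmetric]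
    by (simp add: weighted_shift_weighted_powers)
  ultimately show ?thesis by (auto simp: point_spectrum_iff[OF complex_operator_shift])
qed

lemma not_jamison_sequence_fact: "\<not> jamison_sequence (\<lambda>k. fact (Suc k))"
proof
  assume "jamison_sequence (\<lambda>k. fact (Suc k))"
  then have "countable (point_spectrum shift \<inter> sphere 0 1)"
    by (rule jamison_sequence_imp_countable[OF _ separable_shift_space complex_operator_shift
          partially_power_bounded_shift])
  moreover have "range circle_point \<subseteq> point_spectrum shift \<inter> sphere 0 1"
    using circle_point_in_point_spectrum by auto
  ultimately have "countable (range circle_point)" by (rule countable_subset[rotated])
  then show False using uncountable_range_circle_point by simp
qed

lemma increasing_positive_fact: "increasing_positive (\<lambda>k. fact (Suc k))"
  unfolding increasing_positive_def
proof
  show "strict_mono (\<lambda>k. fact (Suc k) :: nat)" by (rule strict_monoI_Suc) simp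
qed simp

theorem proposition2p14:
  assumes "hereditarily_indecomposable TYPE('a::complex_banach)"
  shows "\<not> universal_jamison_space TYPE('a)"
proof
  assume "universal_jamison_space TYPE('a)"
  then obtain T :: "'a \<Rightarrow> 'a" where T: "complex_operator T" "uncountable (point_spectrum T \<inter> sphere 0 1)"
    using increasing_positive_fact not_jamison_sequence_fact unfolding universal_jamison_space_def
    by blast
  obtain l0 where "\<And>l. l \<noteq> l0 \<Longrightarrow> upper_semi_fredholm (\<lambda>x. T x - l *\<^sub>C x)"
    using hereditarily_indecomposable_fredholm[OF assms T(1)] by blast
  then have "countable (point_spectrum T)" by (rule countable_point_spectrum[OF T(1)])
  then have "countable (point_spectrum T \<inter> sphere 0 1)" by (rule countable_subset[rotated]) blast
  with T(2) show False by contradiction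
qed

end
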